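(* Let $N\ge 1$, let $\tau\in\mathbb C$ with $\mathrm{Im}\,\tau>0$, and let $R^{\hbar}_{ab}(z,w)=R^{\mathrm{ACF}}_{ab}(\hbar,z,w|\,u)$ be the elliptic Arutyunov–Chekhov–Frolov $R$-matrix (defined in the context) with dynamical parameters $u=(u_1,\dots,u_N)$. Then the following two identities hold in $\mathrm{Mat}(N,\mathbb C)^{\otimes 3}$, as identities of meromorphic functions of $\hbar,\eta,z_1,z_2,z_3,u_1,\dots,u_N$. (1) Associative Yang–Baxter equation with shifted spectral parameters: $$R^{\hbar}_{12}(z_1+\eta,z_2+\eta)\,R^{\eta}_{23}(z_2+\hbar,z_3+\hbar)=R^{\eta}_{13}(z_1+\hbar,z_3+\hbar)\,R^{\hbar-\eta}_{12}(z_1+\eta,z_2+\eta)+R^{\eta-\hbar}_{23}(z_2+\hbar,z_3+\hbar)\,R^{\hbar}_{13}(z_1+\eta,z_3+\eta).$$ (2) Cubic identity: $$R^{\eta}_{12}(z_1,z_2)\,R^{\hbar}_{13}(z_1-\hbar,z_3-\hbar)\,R^{\eta}_{23}(z_2,z_3)-R^{\hbar}_{23}(z_2-\hbar,z_3-\hbar)\,R^{\eta}_{13}(z_1,z_3)\,R^{\hbar}_{12}(z_1-\hbar,z_2-\hbar)=\bigl(\wp(\eta)-\wp(\hbar)\bigr)\,R^{\hbar+\eta}_{13}(z_1-\hbar,z_3-\hbar).$$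
   Context: Theta functions with characteristics: $\theta\left[{a\atop b}\right](z|\tau)=\sum_{j\in\mathbb Z}\exp\left(\pi\imath\tau(j+a)^2+2\pi\imath(j+a)(z+b)\right)$. Set $\vartheta(z)=\theta\left[{1/2\atop 1/2}\right](z|\tau)$ (odd theta function). Kronecker function: $\phi(\eta,z)=\dfrac{\vartheta'(0)\,\vartheta(\eta+z)}{\vartheta(\eta)\,\vartheta(z)}$. First Eisenstein function: $E_1(z)=\vartheta'(z)/\vartheta(z)$. Weierstrass function: $\wp(z)=-\partial_zE_1(z)+\frac13\frac{\vartheta'''(0)}{\vartheta'(0)}$. $E_{ij}$ is the standard matrix-unit basis of $\mathrm{Mat}(N,\mathbb C)$, and $u_{ij}=u_i-u_j$. The ACF $R$-matrix is the element of $\mathrm{Mat}(N,\mathbb C)^{\otimes 2}$ $$R^{\mathrm{ACF}}_{12}(\hbar,z_1,z_2|\,u)=\sum_{i\ne j}E_{ii}\otimes E_{jj}\,\phi(\hbar,-u_{ij})+\sum_{i\ne j}E_{ij}\otimes E_{ji}\,\phi(z_1-z_2,-u_{ij})-\sum_{i\ne j}E_{ij}\otimes E_{jj}\,\phi(z_1+\hbar,-u_{ij})+\sum_{i\ne j}E_{jj}\otimes E_{ij}\,\phi(z_2,-u_{ij})+\bigl(E_1(\hbar)+E_1(z_1-z_2)+E_1(z_2)-E_1(z_1+\hbar)\bigr)\sum_iE_{ii}\otimes E_{ii}.$$ For $a\neq b$, $R^{\hbar}_{ab}(z,w)$ denotes the element of $\mathrm{Mat}(N,\mathbb C)^{\otimes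 3}$ obtained from $R^{\mathrm{ACF}}_{12}(\hbar,z,w|\,u)$ by placing its first tensor factor in the $a$-th position and its second tensor factor in the $b$-th position, with the identity in the remaining position. *)

theory Defs
  imports "HOL-Analysis.Analysis"
begin

section \<open>Elliptic functions\<close>

definition theta_char :: "complex \<Rightarrow> complex \<Rightarrow> complex \<Rightarrow> complex \<Rightarrow> complex" where
  "theta_char a b z \<tau> =
     (\<Sum>\<^sub>\<infinity>j\<in>(UNIV :: int set).
        exp (of_real pi * \<i> * \<tau> * (of_int j + a)\<^sup>2
             + 2 * of_real pi * \<i> * (of_int j + a) * (z + b)))"

definition odd_theta :: "complex \<Rightarrow> complex \<Rightarrow> complex" where
  "odd_theta \<tau> z = theta_char (1/2) (1/2) z \<tau>"

definition kronecker_phi :: "complex \<Rightarrow> complex \<Rightarrow> complex \<Rightarrow> complex" where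
  "kronecker_phi \<tau> \<eta> z =
     deriv (odd_theta \<tau>) 0 * odd_theta \<tau> (\<eta> + z) / (odd_theta \<tau> \<eta> * odd_theta \<tau> z)"

definition eisenstein_E1 :: "complex \<Rightarrow> complex \<Rightarrow> complex" where
  "eisenstein_E1 \<tau> z = deriv (odd_theta \<tau>) z / odd_theta \<tau> z"

definition weierstrass_p :: "complex \<Rightarrow> complex \<Rightarrow> complex" where
  "weierstrass_p \<tau> z =
     - deriv (eisenstein_E1 \<tau>) z
     + 1/3 * ((deriv ^^ 3) (odd_theta \<tau>) 0 / deriv (odd_theta \<tau>) 0)"

section \<open>Tensor products of matrix algebras\<close>

text \<open>
  The algebra of complex matrices of size \<open>N = CARD('n)\<close> is \<^typ>\<open>complex^'n^'n\<close>. Its second and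
  third tensor powers are realised, via the Kronecker product, as the algebras of matrices whose
  rows and columns are indexed by pairs and triples of indices.
\<close>

type_synonym 'n mat_tensor2 = "complex^('n \<times> 'n)^('n \<times> 'n)"
type_synonym 'n mat_tensor3 = "complex^('n \<times> 'n \<times> 'n)^('n \<times> 'n \<times> 'n)"

text \<open>
  The library's \<open>*s\<close> does not provide multiplication of a matrix by a complex scalar: on a matrix
  its scalar argument would be a vector.
\<close>

definition mat_scale :: "complex \<Rightarrow> complex^'c^'r \<Rightarrow> complex^'c^'r"  (infixr "*\<^sub>m" 75) where
  "c *\<^sub>m A = (\<chi> p q. c * A $ p $ q)"

definition mat_unit :: "'n \<Rightarrow> 'n \<Rightarrow> complex^'n^'n" where
  "mat_unit i j = (\<chi> p q. if p = i \<and> q = j then 1 else 0)"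

definition tensor2 :: "complex^'n^'n \<Rightarrow> complex^'n^'n \<Rightarrow> 'n mat_tensor2" where
  "tensor2 A B = (\<chi> p q. A $ fst p $ fst q * B $ snd p $ snd q)"

definition tensor3 ::
  "complex^'n^'n \<Rightarrow> complex^'n^'n \<Rightarrow> complex^'n^'n \<Rightarrow> 'n mat_tensor3" where
  "tensor3 A B C =
     (\<chi> p q. A $ fst p $ fst q * B $ fst (snd p) $ fst (snd q) * C $ snd (snd p) $ snd (snd q))"

text \<open>
  \<open>place a b X\<close>, for distinct \<open>a, b \<in> {1, 2, 3}\<close>, is the linear extension of the map that sends
  \<open>A \<otimes> B\<close> to the pure tensor with \<open>A\<close> in position \<open>a\<close>, \<open>B\<close> in position \<open>b\<close> and the identity matrix
  in the remaining position. The entry of \<open>X\<close> in row \<open>(i, k)\<close> and column \<open>(j, l)\<close> is its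
  coefficient at \<open>E\<^sub>i\<^sub>j \<otimes> E\<^sub>k\<^sub>l\<close>.
\<close>

definition place :: "nat \<Rightarrow> nat \<Rightarrow> ('n::finite) mat_tensor2 \<Rightarrow> 'n mat_tensor3" where
  "place a b X =
     (\<Sum>i\<in>UNIV. \<Sum>j\<in>UNIV. \<Sum>k\<in>UNIV. \<Sum>l\<in>UNIV.
        let M = (\<lambda>_. mat 1)(a := mat_unit i j, b := mat_unit k l)
        in X $ (i, k) $ (j, l) *\<^sub>m tensor3 (M 1) (M 2) (M 3))"

section \<open>The elliptic Arutyunov--Chekhov--Frolov R-matrix\<close>

definition R_ACF ::
  "complex \<Rightarrow> complex^('n::finite) \<Rightarrow> complex \<Rightarrow> complex \<Rightarrow> complex \<Rightarrow> 'n mat_tensor2" where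
  "R_ACF \<tau> u h z1 z2 =
     (\<Sum>(i, j)\<in>{(i, j). i \<noteq> j}.
        kronecker_phi \<tau> h (- (u $ i - u $ j)) *\<^sub>m tensor2 (mat_unit i i) (mat_unit j j))
   + (\<Sum>(i, j)\<in>{(i, j). i \<noteq> j}.
        kronecker_phi \<tau> (z1 - z2) (- (u $ i - u $ j)) *\<^sub>m tensor2 (mat_unit i j) (mat_unit j i))
   - (\<Sum>(i, j)\<in>{(i, j). i \<noteq> j}.
        kronecker_phi \<tau> (z1 + h) (- (u $ i - u $ j)) *\<^sub>m tensor2 (mat_unit i j) (mat_unit j j))
   + (\<Sum>(i, j)\<in>{(i, j). i \<noteq> j}.
        kronecker_phi \<tau> z2 (- (u $ i - u $ j)) *\<^sub>m tensor2 (mat_unit j j) (mat_unit i j))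
   + (eisenstein_E1 \<tau> h + eisenstein_E1 \<tau> (z1 - z2) + eisenstein_E1 \<tau> z2
        - eisenstein_E1 \<tau> (z1 + h))
     *\<^sub>m (\<Sum>i\<in>UNIV. tensor2 (mat_unit i i) (mat_unit i i))"

definition R_leg ::
  "complex \<Rightarrow> complex^('n::finite) \<Rightarrow> nat \<Rightarrow> nat \<Rightarrow> complex \<Rightarrow> complex \<Rightarrow> complex \<Rightarrow> 'n mat_tensor3" where
  "R_leg \<tau> u a b h z w = place a b (R_ACF \<tau> u h z w)"

text \<open>
  \<open>R_regular \<tau> u h z w\<close> says that no denominator occurring in \<open>R_ACF \<tau> u h z w\<close> vanishes. An
  identity between meromorphic expressions in R-matrices is stated as an equality of values at every
  point at which all the R-matrices involved are regular; elsewhere the total division of HOL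
  would assign meaningless values.
\<close>

definition R_regular ::
  "complex \<Rightarrow> complex^('n::finite) \<Rightarrow> complex \<Rightarrow> complex \<Rightarrow> complex \<Rightarrow> bool" where
  "R_regular \<tau> u h z w \<longleftrightarrow>
     odd_theta \<tau> h \<noteq> 0 \<and> odd_theta \<tau> (z - w) \<noteq> 0 \<and> odd_theta \<tau> (z + h) \<noteq> 0 \<and> odd_theta \<tau> w \<noteq> 0 \<and>
     (\<forall>i j. i \<noteq> j \<longrightarrow> odd_theta \<tau> (- (u $ i - u $ j)) \<noteq> 0)"

end

theory Submission
  imports Defs "HOL-Complex_Analysis.Complex_Analysis"
begin

text \<open>
  Let \<open>R\<^sub>a\<^sub>b\<close> act on functions of three indices. In row \<open>(i, j)\<close>, the R-matrix sends \<open>g\<close> to a combination of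
  \<open>g i j\<close>, \<open>g j i\<close>, \<open>g j j\<close> and \<open>g i i\<close>, so each identity splits according to which of the three row
  indices coincide and then by columns. For the associative Yang--Baxter equation, every column of a
  row with distinct indices is a case of Fay's identity for the Kronecker function; if two indices
  coincide one needs its degeneration \<open>\<phi>(a,x)\<phi>(b,x) - \<phi>(c,x)\<phi>(d,x) = \<phi>(a+b,x)(E\<^sub>1(a)+E\<^sub>1(b)-E\<^sub>1(c)-E\<^sub>1(d))\<close>
  for \<open>a + b = c + d\<close>; and if all three coincide, the sums of four \<open>E\<^sub>1\<close> factor into theta functions and
  the equation reduces to Fay's identity again. All of this rests on the three-term relation for the
  odd theta function, which is the Pluecker relation because \<open>\<theta>(x+y)\<theta>(x-y) = f(x)g(y) - g(x)f(y)\<close>.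

  The cubic identity is a formal consequence. Write \<open>R\<^sup>h\<close> without its shifted spectral parameters. With
  skew-symmetry, the associative equation reads
  \<open>R\<^sub>1\<^sub>3\<^sup>h R\<^sub>2\<^sub>3\<^sup>\<eta> = R\<^sub>2\<^sub>3\<^sup>h\<^sup>+\<^sup>\<eta> R\<^sub>1\<^sub>2\<^sup>h - R\<^sub>1\<^sub>2\<^sup>-\<^sup>\<eta> R\<^sub>1\<^sub>3\<^sup>h\<^sup>+\<^sup>\<eta>\<close>. Multiply by \<open>R\<^sub>1\<^sub>2\<^sup>\<eta>\<close> from the left, rewrite
  \<open>R\<^sub>1\<^sub>2\<^sup>\<eta> R\<^sub>2\<^sub>3\<^sup>h\<^sup>+\<^sup>\<eta> = R\<^sub>1\<^sub>3\<^sup>h\<^sup>+\<^sup>\<eta> R\<^sub>1\<^sub>2\<^sup>-\<^sup>h + R\<^sub>2\<^sub>3\<^sup>h R\<^sub>1\<^sub>3\<^sup>\<eta>\<close>, and use unitarity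
  \<open>R\<^sub>1\<^sub>2\<^sup>h R\<^sub>1\<^sub>2\<^sup>-\<^sup>h = \<wp>(z1 - z2) - \<wp>(h)\<close> twice.
\<close>

section \<open>The odd theta function\<close>

text \<open>Completing the square bounds each term by a constant times the exponential of -|j|, so a
  geometric series dominates on each half of the integers.\<close>

lemma gaussian_summable_on_int:
  fixes c d :: real
  assumes "c > 0"
  shows "(\<lambda>j::int. exp (- c * (of_int j)\<^sup>2 + d * \<bar>of_int j\<bar>)) summable_on UNIV"
proof -
  \<comment> \<open>The exponent of \<open>K\<close> is the maximum of - c t^2 + (d + 1) t, attained
    at t = (d + 1) / (2 c).\<close>
  define K where "K = exp ((d + 1)\<^sup>2 / (4 * c))"
  have bound: "exp (- c * t\<^sup>2 + d * t) \<le> K * exp (- t)" for t :: real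
  proof -
    have "0 \<le> (2 * c * t - (d + 1))\<^sup>2 / (4 * c)" using assms by simp
    also have "\<dots> = c * t\<^sup>2 - (d + 1) * t + (d + 1)\<^sup>2 / (4 * c)"
      using assms by (simp add: field_simps power2_eq_square)
    finally have "- c * t\<^sup>2 + d * t \<le> (d + 1)\<^sup>2 / (4 * c) + (- t)"
      by (simp add: algebra_simps)
    thus ?thesis unfolding K_def exp_add[symmetric] by simp
  qed
  have geometric: "(\<lambda>n::nat. K * exp (- real n)) summable_on UNIV"
  proof -
    have "summable (\<lambda>n. exp (-1 :: real) ^ n)" by (rule summable_geometric) simp
    hence "summable (\<lambda>n. K * exp (- real n))"
      by (intro summable_mult) (simp add: exp_of_nat_mult[symmetric])
    thus ?thesis by (intro norm_summable_imp_summable_on) (simp add: K_def)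
  qed
  have nat: "(\<lambda>n::nat. exp (- c * (real n)\<^sup>2 + d * real n)) summable_on UNIV"
    using bound by (intro summable_on_comparison_test[OF geometric]) auto
  have "(\<lambda>j::int. exp (- c * (of_int j)\<^sup>2 + d * \<bar>of_int j\<bar>)) summable_on (range int)"
    by (subst summable_on_reindex) (use nat in \<open>simp_all add: o_def\<close>)
  moreover have "(\<lambda>j::int. exp (- c * (of_int j)\<^sup>2 + d * \<bar>of_int j\<bar>)) summable_on (range (\<lambda>n. - int n))"
    by (subst summable_on_reindex) (use nat in \<open>simp_all add: o_def inj_on_def\<close>)
  moreover have "range int \<union> range (\<lambda>n. - int n) = UNIV"
    by (auto intro: int_cases2 simp: image_iff)
  ultimately show ?thesis by (metis summable_on_union)
qed

lemma exp_quadratic_summable_on: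
  fixes a b c :: complex
  assumes "Re a < 0"
  shows "(\<lambda>j::int. norm (exp (a * (of_int j)\<^sup>2 + b * of_int j + c))) summable_on UNIV"
proof (rule summable_on_comparison_test)
  show "(\<lambda>j::int. exp (Re c) * exp (- (- Re a) * (of_int j)\<^sup>2 + \<bar>Re b\<bar> * \<bar>of_int j\<bar>)) summable_on UNIV"
    using assms by (intro summable_on_cmult_right gaussian_summable_on_int) simp
next
  fix j :: int
  have "Re b * of_int j \<le> \<bar>Re b\<bar> * \<bar>of_int j\<bar>"
    by (metis abs_ge_self abs_mult)
  thus "norm (exp (a * (of_int j)\<^sup>2 + b * of_int j + c))
     \<le> exp (Re c) * exp (- (- Re a) * (of_int j)\<^sup>2 + \<bar>Re b\<bar> * \<bar>of_int j\<bar>)"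
    by (simp add: norm_exp_eq_Re exp_add[symmetric] power2_eq_square)
qed auto

text \<open>Fubini for absolutely convergent series. Absolute summability is recorded separately
  because the double series is later split by parity.\<close>

lemma product_abs_summable_on:
  fixes f :: "'a \<Rightarrow> complex" and g :: "'b \<Rightarrow> complex"
  assumes "(\<lambda>x. norm (f x)) summable_on A" "(\<lambda>y. norm (g y)) summable_on B"
  shows "(\<lambda>p. norm ((\<lambda>(x, y). f x * g y) p)) summable_on A \<times> B"
    and "infsum f A * infsum g B = infsum (\<lambda>(x, y). f x * g y) (A \<times> B)"
proof -
  show *: "(\<lambda>p. norm ((\<lambda>(x, y). f x * g y) p)) summable_on A \<times> B"
    unfolding Infinite_Sum.abs_summable_on_Sigma_iff
    using assms by (auto simp: norm_mult infsum_cmult_right' infsum_nonneg intro!: summable_on_cmult_right summable_on_cmult_left)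
  have "infsum (\<lambda>(x, y). f x * g y) (A \<times> B) = infsum (\<lambda>x. infsum (\<lambda>y. f x * g y) B) A"
    using infsum_Sigma'_banach[of "\<lambda>x y. f x * g y" A "\<lambda>_. B"] abs_summable_summable[OF *] by simp
  thus "infsum f A * infsum g B = infsum (\<lambda>(x, y). f x * g y) (A \<times> B)"
    by (simp add: infsum_cmult_right' infsum_cmult_left')
qed

section \<open>The theta series: holomorphy and parity\<close>

definition theta_term :: "complex \<Rightarrow> complex \<Rightarrow> int \<Rightarrow> complex" where
  "theta_term \<tau> z j = exp (of_real pi * \<i> * \<tau> * (of_int j + 1/2)\<^sup>2
             + 2 * of_real pi * \<i> * (of_int j + 1/2) * (z + 1/2))"

lemma odd_theta_altdef: "odd_theta \<tau> z = infsum (theta_term \<tau> z) UNIV"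
  by (simp add: odd_theta_def theta_char_def theta_term_def[abs_def])

lemma theta_term_alt:
  "theta_term \<tau> z j = exp (of_real pi * \<i> * \<tau> * (of_int j)\<^sup>2
     + (of_real pi * \<i> * \<tau> + 2 * of_real pi * \<i> * (z + 1/2)) * of_int j
     + (of_real pi * \<i> * \<tau> / 4 + of_real pi * \<i> * (z + 1/2)))"
  unfolding theta_term_def by (rule arg_cong[of _ _ exp]) (simp add: field_simps power2_eq_square)

lemma theta_term_abs_summable:
  assumes "Im \<tau> > 0"
  shows "(\<lambda>j. norm (theta_term \<tau> z j)) summable_on UNIV"
  unfolding theta_term_alt by (rule exp_quadratic_summable_on) (use assms in simp)

text \<open>On each ball the Weierstrass M-test gives uniform convergence of the finite partial
  sums, which are entire.\<close>

lemma odd_theta_holomorphic: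
  assumes "Im \<tau> > 0"
  shows "odd_theta \<tau> holomorphic_on UNIV"
proof -
  have "odd_theta \<tau> holomorphic_on ball 0 r" for r
  proof (cases "r > 0")
    case True
    \<comment> \<open>A majorant depending on z only through the radius: |Im z| is replaced by r,
      and the constant factor is generous.\<close>
    define M where "M j = exp (2 * pi * r + pi * Im \<tau>) * exp (- (pi * Im \<tau>) * (of_int j)\<^sup>2
        + (2 * pi * r + pi * Im \<tau>) * \<bar>of_int j\<bar>)" for j :: int
    have bound: "norm (theta_term \<tau> z j) \<le> M j" if "z \<in> cball 0 r" for z j
    proof -
      have *: "\<bar>Im z\<bar> \<le> r" using that abs_Im_le_cmod[of z] by simp
      have "- (Im z * (of_int j)) \<le> r * \<bar>of_int j\<bar>"
      proof -
        have "- (Im z * (of_int j)) \<le> \<bar>Im z\<bar> * \<bar>of_int j\<bar>" by (metis abs_ge_minus_self abs_mult)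
        also have "\<dots> \<le> r * \<bar>of_int j\<bar>" using * by (intro mult_right_mono) auto
        finally show ?thesis .
      qed
      hence 1: "pi * (- (Im z * (of_int j))) \<le> pi * (r * \<bar>of_int j\<bar>)" by (intro mult_left_mono) auto
      have 2: "pi * (- Im z) \<le> pi * r" using * by (intro mult_left_mono) auto
      have 3: "(pi * Im \<tau>) * (- of_int j) \<le> (pi * Im \<tau>) * \<bar>of_int j\<bar>"
        using assms by (intro mult_left_mono) auto
      have 4: "pi * r \<ge> 0" "pi * Im \<tau> \<ge> 0" using True assms by auto
      show ?thesis
        unfolding theta_term_alt M_def exp_add[symmetric] norm_exp_eq_Re exp_le_cancel_iff
        using 1 2 3 4 by (simp add: algebra_simps power2_eq_square)
    qed
    have "M summable_on UNIV"
      unfolding M_def using assms by (intro summable_on_cmult_right gaussian_summable_on_int) simp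
    with bound have limit: "uniform_limit (cball 0 r) (\<lambda>X z. \<Sum>j\<in>X. theta_term \<tau> z j) (\<lambda>z. \<Sum>\<^sub>\<infinity>j. theta_term \<tau> z j)
        (finite_subsets_at_top UNIV)"
      by (intro Weierstrass_m_test_general[where M = M]) auto
    have "\<forall>\<^sub>F X in finite_subsets_at_top UNIV. continuous_on (cball 0 r) (\<lambda>z. \<Sum>j\<in>X. theta_term \<tau> z j)
        \<and> (\<lambda>z. \<Sum>j\<in>X. theta_term \<tau> z j) holomorphic_on ball 0 r"
      unfolding theta_term_def by (intro always_eventually allI conjI continuous_intros holomorphic_intros)
    thus ?thesis
      unfolding odd_theta_altdef[abs_def]
      by (rule holomorphic_uniform_limit[OF _ limit]) simp_all
  qed (simp add: not_less ball_empty holomorphic_on_empty)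
  hence "odd_theta \<tau> field_differentiable at z" for z
    using holomorphic_on_imp_differentiable_at[of "odd_theta \<tau>" "ball 0 (norm z + 1)" z] by simp
  thus ?thesis by (simp add: holomorphic_on_def field_differentiable_at_within)
qed

text \<open>The reindexing j to -j - 1 negates j + 1/2. The characteristic b = 1/2 then contributes
  the factor exp (- (2 j + 1) pi \<i>) = -1 to each term.\<close>

lemma odd_theta_minus: "odd_theta \<tau> (- z) = - odd_theta \<tau> z"
proof -
  have "theta_term \<tau> (- z) (- j - 1) = - theta_term \<tau> z j" for j
  proof -
    have "theta_term \<tau> (- z) (- j - 1)
      = exp (of_real pi * \<i> * \<tau> * (of_int j + 1/2)\<^sup>2
             + 2 * of_real pi * \<i> * (of_int j + 1/2) * (z + 1/2)
             - (2 * of_int j * pi * \<i> + of_real pi * \<i>))"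
      unfolding theta_term_def by (rule arg_cong[of _ _ exp]) (simp add: field_simps power2_eq_square)
    also have "\<dots> = theta_term \<tau> z j / (exp (2 * of_int j * pi * \<i>) * exp (of_real pi * \<i>))"
      unfolding theta_term_def exp_diff exp_add by simp
    also have "exp (2 * of_int j * pi * \<i>) = 1" by (metis exp_two_pi_i exp_integer_2pi Ints_of_int)
    finally show ?thesis by simp
  qed
  hence "infsum (\<lambda>j. theta_term \<tau> (- z) (- j - 1)) UNIV = - odd_theta \<tau> z"
    by (simp add: odd_theta_altdef infsum_uminus)
  moreover have "infsum (\<lambda>j. theta_term \<tau> (- z) (- j - 1)) UNIV = odd_theta \<tau> (- z)"
    unfolding odd_theta_altdef
    by (rule infsum_reindex_bij_witness[where i = "\<lambda>j. -j - 1" and j = "\<lambda>j. -j-1"]) auto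
  ultimately show ?thesis by simp
qed

text \<open>Summing over \<open>m = j + k + 1\<close> and \<open>n = j - k\<close>, which have opposite parity, separates the
  variables in \<open>\<theta> (x + y) \<theta> (x - y)\<close>.\<close>

lemma odd_theta_add_diff:
  assumes "Im \<tau> > 0"
  obtains F G :: "complex \<Rightarrow> complex" where
    "\<And>x y. odd_theta \<tau> (x + y) * odd_theta \<tau> (x - y) = F x * G y - G x * F y"
proof -
  \<comment> \<open>\<open>f\<close> and \<open>g\<close> are the terms of the theta functions of
    modulus 2 \<tau> at 2 x with characteristics (0, 0) and (1/2, 0): p runs over integers in
    \<open>f\<close>, p + 1/2 over half-integers in \<open>g\<close>.\<close>
  define f where "f x p = exp (2 * of_real pi * \<i> * \<tau> * (of_int p)\<^sup>2 + 4 * of_real pi * \<i> * x * of_int p)"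
    for x :: complex and p :: int
  define g where "g x p = exp (2 * of_real pi * \<i> * \<tau> * (of_int p + 1/2)\<^sup>2
       + 4 * of_real pi * \<i> * x * (of_int p + 1/2))" for x :: complex and p :: int
  have f: "(\<lambda>p. norm (f x p)) summable_on UNIV" for x
    using exp_quadratic_summable_on[of "2 * of_real pi * \<i> * \<tau>" "4 * of_real pi * \<i> * x" 0] assms
    unfolding f_def by simp
  have g_alt: "g x p = exp (2 * of_real pi * \<i> * \<tau> * (of_int p)\<^sup>2
     + (2 * of_real pi * \<i> * \<tau> + 4 * of_real pi * \<i> * x) * of_int p
     + (of_real pi * \<i> * \<tau> / 2 + 2 * of_real pi * \<i> * x))" for x p
    unfolding g_def by (rule arg_cong[of _ _ exp]) (simp add: field_simps power2_eq_square)
  have g: "(\<lambda>p. norm (g x p)) summable_on UNIV" for x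
    unfolding g_alt by (rule exp_quadratic_summable_on) (use assms in simp)
  have fg: "theta_term \<tau> (x + y) (p + q) * theta_term \<tau> (x - y) (p - q - 1) = f x p * g y q" for x y p q
  proof -
    have "theta_term \<tau> (x + y) (p + q) * theta_term \<tau> (x - y) (p - q - 1)
      = exp (2 * of_int p * pi * \<i>) * (f x p * g y q)"
      unfolding theta_term_def f_def g_def exp_add[symmetric]
      by (rule arg_cong[of _ _ exp]) (simp add: field_simps power2_eq_square)
    also have "exp (2 * of_int p * pi * \<i>) = 1" by (metis exp_integer_2pi Ints_of_int)
    finally show ?thesis by simp
  qed
  \<comment> \<open>Here the shifted indices add up to 2 p + 1 instead of 2 p, so the characteristic
    1/2 produces the sign.\<close>
  have gf: "theta_term \<tau> (x + y) (p + q) * theta_term \<tau> (x - y) (p - q) = - (g x p * f y q)" for x y p q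
  proof -
    have "theta_term \<tau> (x + y) (p + q) * theta_term \<tau> (x - y) (p - q)
      = exp (2 * of_int p * pi * \<i>) * exp (of_real pi * \<i>) * (g x p * f y q)"
      unfolding theta_term_def f_def g_def exp_add[symmetric]
      by (rule arg_cong[of _ _ exp]) (simp add: field_simps power2_eq_square)
    also have "exp (2 * of_int p * pi * \<i>) = 1" by (metis exp_integer_2pi Ints_of_int)
    finally show ?thesis by simp
  qed
  have "odd_theta \<tau> (x + y) * odd_theta \<tau> (x - y)
      = infsum (f x) UNIV * infsum (g y) UNIV - infsum (g x) UNIV * infsum (f y) UNIV" for x y
  proof -
    define T where "T = (\<lambda>(j, k). theta_term \<tau> (x + y) j * theta_term \<tau> (x - y) k)"
    \<comment> \<open>\<open>A\<close> consists of the pairs with j - k odd, \<open>B\<close> of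
      those with j - k even.\<close>
    define A where "A = range (\<lambda>(p, q). (p + q, p - q - 1 :: int))"
    define B where "B = range (\<lambda>(p, q). (p + q, p - q :: int))"
    have T: "(\<lambda>p. norm (T p)) summable_on UNIV \<times> UNIV"
      unfolding T_def by (intro product_abs_summable_on theta_term_abs_summable assms)
    have AB: "A \<union> B = UNIV"
    proof -
      have "(j, k) \<in> A \<union> B" for j k
      proof (cases "even (j - k)")
        case True
        then obtain q where "j - k = 2 * q" by (elim evenE)
        hence "(j, k) = (\<lambda>(p, q). (p + q, p - q)) (k + q, q)" by simp
        thus ?thesis unfolding B_def by blast
      next
        case False
        then obtain q where "j - k = 2 * q + 1" by (elim oddE)
        hence "(j, k) = (\<lambda>(p, q). (p + q, p - q - 1)) (k + q + 1, q)" by simp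
        thus ?thesis unfolding A_def by blast
      qed
      thus ?thesis by auto
    qed
    have disj: "A \<inter> B = {}" unfolding A_def B_def by auto presburger
    have "odd_theta \<tau> (x + y) * odd_theta \<tau> (x - y) = infsum T (A \<union> B)"
      unfolding odd_theta_altdef T_def AB
      by (subst product_abs_summable_on(2)) (simp_all add: theta_term_abs_summable assms)
    also have "\<dots> = infsum T A + infsum T B"
    proof (rule infsum_Un_disjoint[OF _ _ disj])
      have "T summable_on UNIV" using abs_summable_summable[OF T] by simp
      thus "T summable_on A" "T summable_on B" by (auto intro: summable_on_subset)
    qed
    also have "infsum T A = infsum (\<lambda>(p, q). f x p * g y q) (UNIV \<times> UNIV)"
      unfolding A_def by (subst infsum_reindex) (auto simp: inj_on_def o_def T_def fg case_prod_unfold)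
    also have "\<dots> = infsum (f x) UNIV * infsum (g y) UNIV"
      by (intro product_abs_summable_on(2)[symmetric] f g)
    also have "infsum T B = infsum (\<lambda>(p, q). - (g x p * f y q)) (UNIV \<times> UNIV)"
      unfolding B_def by (subst infsum_reindex) (auto simp: inj_on_def o_def T_def gf case_prod_unfold)
    also have "\<dots> = - infsum (\<lambda>(p, q). g x p * f y q) (UNIV \<times> UNIV)"
      by (simp add: case_prod_unfold infsum_uminus)
    also have "infsum (\<lambda>(p, q). g x p * f y q) (UNIV \<times> UNIV) = infsum (g x) UNIV * infsum (f y) UNIV"
      by (intro product_abs_summable_on(2)[symmetric] f g)
    finally show ?thesis by simp
  qed
  thus ?thesis by (rule that)
qed

text \<open>Each product t (x + y) t (x - y) is a 2 x 2 minor of the matrix with columns (F, G) at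
  x, y, z, w, and the minors of a 2 x 4 matrix satisfy the Pluecker relation.\<close>

lemma odd_theta_three_term:
  assumes "Im \<tau> > 0"
  defines "t \<equiv> odd_theta \<tau>"
  shows "t (x + y) * t (x - y) * t (z + w) * t (z - w)
       - t (x + z) * t (x - z) * t (y + w) * t (y - w)
       + t (x + w) * t (x - w) * t (y + z) * t (y - z) = 0"
proof -
  obtain F G where FG: "\<And>x y. t (x + y) * t (x - y) = F x * G y - G x * F y"
    using odd_theta_add_diff[OF assms(1)] unfolding t_def by blast
  have "t (x + y) * t (x - y) * t (z + w) * t (z - w)
       - t (x + z) * t (x - z) * t (y + w) * t (y - w)
       + t (x + w) * t (x - w) * t (y + z) * t (y - z)
     = (t (x + y) * t (x - y)) * (t (z + w) * t (z - w))
       - (t (x + z) * t (x - z)) * (t (y + w) * t (y - w))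
       + (t (x + w) * t (x - w)) * (t (y + z) * t (y - z))"
    by (simp add: mult.assoc)
  also have "\<dots> = 0" unfolding FG by (simp add: algebra_simps)
  finally show ?thesis .
qed

section \<open>Identities for the Kronecker function\<close>

locale theta_modulus =
  fixes \<tau> :: complex
  assumes Im_pos: "Im \<tau> > 0"
begin

abbreviation t where "t \<equiv> odd_theta \<tau>"
abbreviation \<phi> where "\<phi> \<equiv> kronecker_phi \<tau>"
abbreviation E where "E \<equiv> eisenstein_E1 \<tau>"

lemma t_minus: "t (- z) = - t z"
  by (rule odd_theta_minus)

lemma t_diff_commute: "t (x - y) = - t (y - x)"
  using t_minus[of "y - x"] by simp

lemma t_0: "t 0 = 0"
  using t_minus[of 0] by simp

lemmas three_term = odd_theta_three_term[OF Im_pos]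

lemma t_DERIV [derivative_intros]:
  assumes "(g has_field_derivative g') (at x within S)"
  shows "((\<lambda>x. t (g x)) has_field_derivative deriv t (g x) * g') (at x within S)"
proof -
  have "t field_differentiable at (g x)"
    using odd_theta_holomorphic[OF Im_pos] by (simp add: holomorphic_on_def)
  hence "(t has_field_derivative deriv t (g x)) (at (g x))"
    by (simp add: DERIV_deriv_iff_field_differentiable)
  from DERIV_chain2[OF this assms] show ?thesis .
qed

lemma isCont_t: "isCont t z"
  using t_DERIV[OF DERIV_ident, of z UNIV] by (simp add: DERIV_isCont)

lemma phi_commute: "\<phi> a x = \<phi> x a"
  by (simp add: kronecker_phi_def add.commute mult.commute)

lemma phi_minus: "\<phi> (- a) (- x) = - \<phi> a x"
  using t_minus[of "a + x"] by (simp add: kronecker_phi_def t_minus)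

text \<open>Differentiating the oddness relation shows that the derivative of theta is even.\<close>

lemma E_minus: "E (- x) = - E x"
proof -
  have "((\<lambda>x. t (- x)) has_field_derivative - deriv t (- x)) (at x)"
    by (auto intro!: derivative_eq_intros)
  moreover have "((\<lambda>x. - t x) has_field_derivative - deriv t x) (at x)"
    by (auto intro!: derivative_eq_intros)
  ultimately have "deriv t (- x) = deriv t x"
    unfolding t_minus using DERIV_unique by fastforce
  thus ?thesis by (simp add: eisenstein_E1_def t_minus)
qed

section \<open>Fay's identity and its degeneration\<close>

lemma fay:
  assumes "t a \<noteq> 0" "t b \<noteq> 0" "t (a + b) \<noteq> 0" "t x \<noteq> 0" "t y \<noteq> 0" "t (x - y) \<noteq> 0"
  shows "\<phi> a x * \<phi> b y = \<phi> a (x - y) * \<phi> (a + b) y + \<phi> b (y - x) * \<phi> (a + b) x"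
proof -
  have "t (a + x) * t (b + y) * t (a + b) * t (x - y)
     - t (a + b + x) * t y * t a * t (x - b - y)
     + t (a + b + y) * t x * t (a + x - y) * t (- b) = 0"
  proof -
    \<comment> \<open>Half-sum and half-difference of a + x and b + y, and of a + b and x - y, so
      that these four become X + Y, X - Y, Z + W and Z - W.\<close>
    define X Y Z W where "X = (a + x + b + y) / 2" and "Y = (a + x - b - y) / 2"
      and "Z = (a + b + x - y) / 2" and "W = (a + b - x + y) / 2"
    have "X + Y = a + x" "X - Y = b + y" "Z + W = a + b" "Z - W = x - y" "X + Z = a + b + x" "X - Z = y"
         "Y + W = a" "Y - W = x - b - y" "X + W = a + b + y" "X - W = x" "Y + Z = a + x - y" "Y - Z = - b"
      unfolding X_def Y_def Z_def W_def by (simp_all add: field_simps)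
    thus ?thesis using three_term[of X Y Z W] by simp
  qed
  moreover have "t (x - b - y) = - t (b + (y - x))"
    using t_minus[of "b + (y - x)"] by (simp add: algebra_simps)
  ultimately have "t (a + x) * t (b + y) * t (a + b) * t (x - y)
    = t (a + (x - y)) * t (a + b + y) * t b * t x - t (b + (y - x)) * t (a + b + x) * t a * t y"
    by (simp add: t_minus algebra_simps)
  thus ?thesis using assms t_diff_commute[of x y] unfolding kronecker_phi_def
    by (simp add: divide_simps) algebra
qed

text \<open>The derivative of the three-term relation in w at w = z. The factor t (z - w) vanishes
  there, so its product contributes only \<open>deriv t 0\<close>; the other terms become
  logarithmic derivatives after division.\<close>

lemma E_sum:
  assumes "t a \<noteq> 0" "t b \<noteq> 0" "t c \<noteq> 0" "t d \<noteq> 0" "a + b = c + d"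
  shows "E a + E b - E c - E d = deriv t 0 * t (a + b) * t (a - c) * t (a - d) / (t a * t b * t c * t d)"
proof -
  \<comment> \<open>Since a + b = c + d, the differences a - c and d - b are equal; z is half of
    them, and x and y are the midpoints of the two pairs.\<close>
  define z where "z = (a - c) / 2"
  define x where "x = (a + c) / 2"
  define y where "y = b + z"
  have eqs: "x + z = a" "x - z = c" "y - z = b" "y + z = d" "x + y = a + b" "x - y = a - d" "z + z = a - c"
    using assms(5) unfolding x_def y_def z_def by (auto simp: field_simps) algebra+
  define F where "F w = t (x + y) * t (x - y) * t (z + w) * t (z - w)
       - t (x + z) * t (x - z) * t (y + w) * t (y - w)
       + t (x + w) * t (x - w) * t (y + z) * t (y - z)" for w
  have "(F has_field_derivative
     (- t (x + y) * t (x - y) * t (z + z) * deriv t 0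
      - t (x + z) * t (x - z) * (deriv t (y + z) * t (y - z) - t (y + z) * deriv t (y - z))
      + (deriv t (x + z) * t (x - z) - t (x + z) * deriv t (x - z)) * t (y + z) * t (y - z))) (at z)"
    unfolding F_def by (rule derivative_eq_intros refl)+ (simp add: t_0 algebra_simps)
  moreover have "F = (\<lambda>_. 0)" unfolding F_def using three_term by blast
  hence "(F has_field_derivative 0) (at z)" by simp
  ultimately have "- t (x + y) * t (x - y) * t (z + z) * deriv t 0
      - t (x + z) * t (x - z) * (deriv t (y + z) * t (y - z) - t (y + z) * deriv t (y - z))
      + (deriv t (x + z) * t (x - z) - t (x + z) * deriv t (x - z)) * t (y + z) * t (y - z) = 0"
    using DERIV_unique by blast
  hence "- t (a + b) * t (a - d) * t (a - c) * deriv t 0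
      - t a * t c * (deriv t d * t b - t d * deriv t b)
      + (deriv t a * t c - t a * deriv t c) * t d * t b = 0"
    unfolding eqs .
  thus ?thesis using assms(1-4) unfolding eisenstein_E1_def
    by (simp add: divide_simps) algebra
qed

text \<open>The three-term relation factors the numerator of the left side, and \<open>E_sum\<close>
  turns the right side into the same theta quotient. Taking a difference of two products with equal
  a + b avoids a limit in Fay's identity at x = y.\<close>

lemma fay_degenerate:
  assumes "t a \<noteq> 0" "t b \<noteq> 0" "t c \<noteq> 0" "t d \<noteq> 0" "t (a + b) \<noteq> 0" "t x \<noteq> 0" "a + b = c + d"
  shows "\<phi> a x * \<phi> b x - \<phi> c x * \<phi> d x = \<phi> (a + b) x * (E a + E b - E c - E d)"
proof -
  have d: "d = a + b - c" using assms(7) by (simp add: algebra_simps)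
  have "t (a + x) * t (b + x) * t c * t d - t (c + x) * t (d + x) * t a * t b
      = t (a + b + x) * t x * t (a - c) * t (a - d)"
  proof -
    \<comment> \<open>Half-sum and half-difference of a + x and b + x, and of c and d.\<close>
    define X Y Z W where "X = (a + b) / 2 + x" and "Y = (a - b) / 2"
      and "Z = (c + d) / 2" and "W = (c - d) / 2"
    have eqs: "X + Y = a + x" "X - Y = b + x" "Z + W = c" "Z - W = d" "X + Z = a + b + x" "X - Z = x"
         "Y + W = a - d" "Y - W = a - c" "X + W = c + x" "X - W = d + x" "Y + Z = a" "Y - Z = - b"
      unfolding X_def Y_def Z_def W_def d by (simp_all add: field_simps)
    show ?thesis using three_term[of X Y Z W] unfolding eqs t_minus by algebra
  qed
  moreover have "\<phi> (a + b) x * (E a + E b - E c - E d) = deriv t 0 ^ 2 * (t (a + b + x) * t x * t (a - c) * t (a - d))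
       / (t x ^ 2 * t a * t b * t c * t d)"
    unfolding E_sum[OF assms(1-4,7)] kronecker_phi_def using assms by (simp add: divide_simps power2_eq_square)
  ultimately show ?thesis using assms(1-6) unfolding kronecker_phi_def
    by (simp add: divide_simps power2_eq_square) algebra
qed

section \<open>Differences of Weierstrass functions\<close>

lemma E_DERIV: "t x \<noteq> 0 \<Longrightarrow> (E has_field_derivative deriv E x) (at x)"
proof -
  assume "t x \<noteq> 0"
  moreover have op: "open (UNIV - {z. t z = 0})"
  proof -
    have "closed (t -` {0})"
      by (rule closed_vimage)
        (use holomorphic_on_imp_continuous_on[OF odd_theta_holomorphic[OF Im_pos]] in auto)
    hence "open (- (t -` {0}))" by (rule open_Compl)
    also have "- (t -` {0}) = UNIV - {z. t z = 0}" by auto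
    finally show ?thesis .
  qed
  moreover have "E holomorphic_on (UNIV - {z. t z = 0})"
    unfolding eisenstein_E1_def[abs_def]
    using odd_theta_holomorphic[OF Im_pos]
    by (intro holomorphic_intros holomorphic_deriv op) (auto intro: holomorphic_on_subset)
  ultimately show ?thesis by (intro holomorphic_derivI) auto
qed

text \<open>With d = a + b - c, both sides of \<open>E_sum\<close> vanish at c = a. Their first
  derivatives there give the formula, and the constant in \<open>weierstrass_p\<close>
  cancels.\<close>

lemma wp_diff:
  assumes "t a \<noteq> 0" "t b \<noteq> 0"
  shows "weierstrass_p \<tau> a - weierstrass_p \<tau> b = - (deriv t 0)\<^sup>2 * t (a + b) * t (a - b) / (t a ^ 2 * t b ^ 2)"
proof -
  \<comment> \<open>\<open>F\<close> and \<open>G\<close> are the two sides of \<open>E_sum\<close>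
    after clearing denominators; they are compared only near c = a.\<close>
  define F where "F c = t a * t b * t c * t (a + b - c) * (E a + E b - E c - E (a + b - c))" for c
  define G where "G c = deriv t 0 * t (a + b) * t (a - c) * t (c - b)" for c
  have "\<forall>\<^sub>F c in at a. t c \<noteq> 0"
    using isCont_t[of a] assms(1) by (simp add: isCont_def tendsto_imp_eventually_ne)
  hence 1: "\<forall>\<^sub>F c in nhds a. t c \<noteq> 0"
    using assms(1) by (simp add: eventually_nhds_conv_at)
  have "isCont (\<lambda>c. t (a + b - c)) a"
    by (rule isCont_o2[OF _ isCont_t]) (intro continuous_intros)
  hence "\<forall>\<^sub>F c in at a. t (a + b - c) \<noteq> 0"
    using assms(2) unfolding isCont_def by (intro tendsto_imp_eventually_ne) auto
  hence 2: "\<forall>\<^sub>F c in nhds a. t (a + b - c) \<noteq> 0"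
    using assms(2) by (simp add: eventually_nhds_conv_at)
  have "\<forall>\<^sub>F c in nhds a. F c = G c"
    using 1 2
  proof eventually_elim
    case (elim c)
    thus ?case
      using E_sum[of a b c "a + b - c"] assms t_diff_commute[of c b]
      by (simp add: F_def G_def)
  qed
  moreover have "(F has_field_derivative (t a * t b * t a * t b * (- deriv E a + deriv E b))) (at a)"
  proof -
    have "((\<lambda>c. E (a + b - c)) has_field_derivative - deriv E b) (at a)"
    proof -
      have "((\<lambda>c. a + b - c) has_field_derivative -1) (at a)"
        by (auto intro!: derivative_eq_intros)
      with E_DERIV[OF assms(2)] show ?thesis
        using DERIV_chain2[of E "deriv E b" "\<lambda>c. a + b - c" a "-1" UNIV] by simp
    qed
    from this E_DERIV[OF assms(1)] show ?thesis
      unfolding F_def by (auto intro!: derivative_eq_intros)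
  qed
  moreover have "(G has_field_derivative (- (deriv t 0)\<^sup>2 * t (a + b) * t (a - b))) (at a)"
    unfolding G_def by (rule derivative_eq_intros refl)+ (simp add: t_0 power2_eq_square algebra_simps)
  ultimately have "t a * t b * t a * t b * (- deriv E a + deriv E b) = - (deriv t 0)\<^sup>2 * t (a + b) * t (a - b)"
    using DERIV_cong_ev DERIV_unique by blast
  moreover have "weierstrass_p \<tau> a - weierstrass_p \<tau> b = - deriv E a + deriv E b"
    by (simp add: weierstrass_p_def)
  ultimately show ?thesis using assms by (simp add: divide_simps) algebra
qed

lemma phi_phi_minus:
  assumes "t a \<noteq> 0" "t x \<noteq> 0"
  shows "\<phi> a x * \<phi> (- a) x = weierstrass_p \<tau> x - weierstrass_p \<tau> a"
  using wp_diff[OF assms(2,1)] assms t_diff_commute[of a x] unfolding kronecker_phi_def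
  by (simp add: t_minus add.commute power2_eq_square mult_ac)

end

section \<open>The R-matrix as an operator\<close>

text \<open>Row (i, j) of the R-matrix as a functional on functions of two indices, so that products
  of legs become nested applications. The last term has the opposite difference of u because it
  comes from the summand at the exchanged pair (j, i).\<close>

definition R_action ::
  "complex \<Rightarrow> complex^'n \<Rightarrow> complex \<Rightarrow> complex \<Rightarrow> complex \<Rightarrow> 'n \<Rightarrow> 'n \<Rightarrow> ('n \<Rightarrow> 'n \<Rightarrow> complex) \<Rightarrow> complex"
where
  "R_action \<tau> u h z w i j g =
    (if i = j
     then (eisenstein_E1 \<tau> h + eisenstein_E1 \<tau> (z - w) + eisenstein_E1 \<tau> w - eisenstein_E1 \<tau> (z + h)) * g i i
     else kronecker_phi \<tau> h (u $ j - u $ i) * g i j + kronecker_phi \<tau> (z - w) (u $ j - u $ i) * g j i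
        - kronecker_phi \<tau> (z + h) (u $ j - u $ i) * g j j + kronecker_phi \<tau> w (u $ i - u $ j) * g i i)"

lemma mat_scale_nth: "(c *\<^sub>m A) $ p $ q = c * A $ p $ q"
  by (simp add: mat_scale_def)

lemma tensor2_mat_unit_nth:
  "tensor2 (mat_unit a b) (mat_unit c d) $ p $ q = (if (a, c) = p then if q = (b, d) then 1 else 0 else 0)"
  by (cases p; cases q) (auto simp: tensor2_def mat_unit_def)

lemma R_ACF_nth:
  "R_ACF \<tau> u h z w $ (i, j) $ q =
    (if i = j
     then (if q = (i, i) then eisenstein_E1 \<tau> h + eisenstein_E1 \<tau> (z - w) + eisenstein_E1 \<tau> w - eisenstein_E1 \<tau> (z + h) else 0)
     else (if q = (i, j) then kronecker_phi \<tau> h (u $ j - u $ i) else 0)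
        + (if q = (j, i) then kronecker_phi \<tau> (z - w) (u $ j - u $ i) else 0)
        - (if q = (j, j) then kronecker_phi \<tau> (z + h) (u $ j - u $ i) else 0)
        + (if q = (i, i) then kronecker_phi \<tau> w (u $ i - u $ j) else 0))"
proof -
  \<comment> \<open>In a fixed row, at most one pair contributes to each of the four off-diagonal
    sums.\<close>
  have single: "(\<Sum>(a, b)\<in>{(a, b). a \<noteq> b}. G a b * T a b)
      = (if k \<noteq> l \<and> q = r then G k l else 0)"
    if "\<And>a b. T a b = (if (a, b) = (k, l) then if q = r then 1 else 0 else 0)"
    for G T :: "'a \<Rightarrow> 'a \<Rightarrow> complex" and k l r
  proof -
    have "(\<Sum>(a, b)\<in>{(a, b). a \<noteq> b}. G a b * T a b)
       = (\<Sum>x\<in>{(a, b). a \<noteq> b}. if x = (k, l) then if q = r then G k l else 0 else 0)"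
      by (intro sum.cong) (auto simp: that split: if_splits)
    also have "\<dots> = (if k \<noteq> l \<and> q = r then G k l else 0)" by (simp add: sum.delta)
    finally show ?thesis .
  qed
  have 1: "(\<Sum>(a, b)\<in>{(a, b). a \<noteq> b}. G a b * tensor2 (mat_unit a a) (mat_unit b b) $ (i, j) $ q)
      = (if i \<noteq> j \<and> q = (i, j) then G i j else 0)" for G
    by (rule single) (auto simp: tensor2_mat_unit_nth)
  have 2: "(\<Sum>(a, b)\<in>{(a, b). a \<noteq> b}. G a b * tensor2 (mat_unit a b) (mat_unit b a) $ (i, j) $ q)
      = (if i \<noteq> j \<and> q = (j, i) then G i j else 0)" for G
    by (rule single) (auto simp: tensor2_mat_unit_nth)
  have 3: "(\<Sum>(a, b)\<in>{(a, b). a \<noteq> b}. G a b * tensor2 (mat_unit a b) (mat_unit b b) $ (i, j) $ q)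
      = (if i \<noteq> j \<and> q = (j, j) then G i j else 0)" for G
    by (rule single) (auto simp: tensor2_mat_unit_nth)
  \<comment> \<open>In the fourth sum the row index is (b, a), hence \<open>G j i\<close>.\<close>
  have 4: "(\<Sum>(a, b)\<in>{(a, b). a \<noteq> b}. G a b * tensor2 (mat_unit b b) (mat_unit a b) $ (i, j) $ q)
      = (if j \<noteq> i \<and> q = (i, i) then G j i else 0)" for G
    by (rule single) (auto simp: tensor2_mat_unit_nth)
  have 5: "(\<Sum>a\<in>UNIV. tensor2 (mat_unit a a) (mat_unit a a) $ (i, j) $ q)
      = (if i = j \<and> q = (i, i) then 1 else 0)"
  proof -
    have "(\<Sum>a\<in>UNIV. tensor2 (mat_unit a a) (mat_unit a a) $ (i, j) $ q)
      = (\<Sum>a\<in>UNIV. if a = i then if i = j \<and> q = (i, i) then 1 else 0 else 0)"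
      by (intro sum.cong) (auto simp: tensor2_mat_unit_nth)
    thus ?thesis by (simp only: sum.delta finite UNIV_I if_True)
  qed
  have "R_ACF \<tau> u h z w $ (i, j) $ q =
      (if i \<noteq> j \<and> q = (i, j) then kronecker_phi \<tau> h (- (u $ i - u $ j)) else 0)
    + (if i \<noteq> j \<and> q = (j, i) then kronecker_phi \<tau> (z - w) (- (u $ i - u $ j)) else 0)
    - (if i \<noteq> j \<and> q = (j, j) then kronecker_phi \<tau> (z + h) (- (u $ i - u $ j)) else 0)
    + (if j \<noteq> i \<and> q = (i, i) then kronecker_phi \<tau> w (- (u $ j - u $ i)) else 0)
    + (eisenstein_E1 \<tau> h + eisenstein_E1 \<tau> (z - w) + eisenstein_E1 \<tau> w - eisenstein_E1 \<tau> (z + h))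
      * (if i = j \<and> q = (i, i) then 1 else 0)"
    using 1[of "\<lambda>a b. kronecker_phi \<tau> h (- (u $ a - u $ b))"]
      2[of "\<lambda>a b. kronecker_phi \<tau> (z - w) (- (u $ a - u $ b))"]
      3[of "\<lambda>a b. kronecker_phi \<tau> (z + h) (- (u $ a - u $ b))"]
      4[of "\<lambda>a b. kronecker_phi \<tau> w (- (u $ a - u $ b))"] 5
    unfolding R_ACF_def
    by (simp only: sum_component mat_scale_nth case_prod_unfold vector_add_component vector_minus_component)
  thus ?thesis by auto
qed

lemma sum_R_ACF:
  "(\<Sum>a\<in>UNIV. \<Sum>b\<in>UNIV. R_ACF \<tau> u h z w $ (i, j) $ (a, b) * g a b) = R_action \<tau> u h z w i j g"
proof -
  have pick: "(\<Sum>a\<in>UNIV. \<Sum>b\<in>UNIV. (if (a, b) = (k, l) then c else 0) * g a b) = c * g k l" for k l c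
  proof -
    have "(\<Sum>a\<in>UNIV. \<Sum>b\<in>UNIV. (if (a, b) = (k, l) then c else 0) * g a b)
        = (\<Sum>a\<in>UNIV. if a = k then \<Sum>b\<in>UNIV. if b = l then c * g a b else 0 else 0)"
      by (intro sum.cong refl) (simp add: if_distrib[of "\<lambda>x. x * _"] cong: if_cong)
    also have "\<dots> = c * g k l" by (simp add: sum.delta)
    finally show ?thesis .
  qed
  show ?thesis
    \<comment> \<open>Without \<open>prod.inject\<close> the column tests stay equations between
      pairs, the form matched by \<open>pick\<close>.\<close>
    by (cases "i = j") (simp_all add: R_ACF_nth R_action_def distrib_right left_diff_distrib
        sum.distrib sum_subtractf pick del: prod.inject)
qed

section \<open>Legs in the triple tensor power\<close>

lemma tensor3_nth: "tensor3 A B C $ (i, j, k) $ (a, b, c) = A $ i $ a * B $ j $ b * C $ k $ c"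
  by (simp add: tensor3_def)

lemma sum_mat_units:
  fixes F :: "'n::finite \<Rightarrow> 'n \<Rightarrow> 'n \<Rightarrow> 'n \<Rightarrow> complex"
  shows "(\<Sum>a\<in>UNIV. \<Sum>b\<in>UNIV. \<Sum>c\<in>UNIV. \<Sum>d\<in>UNIV.
     F a b c d * (mat_unit a b $ i $ j * mat_unit c d $ k $ l)) = F i j k l"
proof -
  have 1: "(\<Sum>a\<in>UNIV. \<Sum>b\<in>UNIV. G a b * mat_unit a b $ i $ j) = G i j"
    for G :: "'n \<Rightarrow> 'n \<Rightarrow> complex" and i j
  proof -
    have "(\<Sum>a\<in>UNIV. \<Sum>b\<in>UNIV. G a b * mat_unit a b $ i $ j)
      = (\<Sum>a\<in>UNIV. if a = i then \<Sum>b\<in>UNIV. if b = j then G a b else 0 else 0)"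
      by (intro sum.cong refl) (simp add: mat_unit_def if_distrib[of "(*) _"] cong: if_cong)
    also have "\<dots> = G i j" by (simp add: sum.delta)
    finally show ?thesis .
  qed
  have "(\<Sum>c\<in>UNIV. \<Sum>d\<in>UNIV. F a b c d * (mat_unit a b $ i $ j * mat_unit c d $ k $ l))
      = F a b k l * mat_unit a b $ i $ j" for a b
    using 1[of "\<lambda>c d. F a b c d * mat_unit a b $ i $ j" k l] by (simp add: mult.assoc)
  thus ?thesis using 1[of "\<lambda>a b. F a b k l" i j] by simp
qed

lemma place_nth:
  "place 1 2 X $ (i, j, k) $ (a, b, c) = X $ (i, j) $ (a, b) * (if k = c then 1 else 0)"
  "place 1 3 X $ (i, j, k) $ (a, b, c) = X $ (i, k) $ (a, c) * (if j = b then 1 else 0)"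
  "place 2 3 X $ (i, j, k) $ (a, b, c) = X $ (j, k) $ (b, c) * (if i = a then 1 else 0)"
proof -
  show "place 1 2 X $ (i, j, k) $ (a, b, c) = X $ (i, j) $ (a, b) * (if k = c then 1 else 0)"
    using sum_mat_units[of "\<lambda>a b d e. X $ (a, d) $ (b, e) * (if k = c then 1 else 0)" i a j b]
    by (simp add: place_def Let_def sum_component mat_scale_nth tensor3_nth mat_def mult_ac)
  show "place 1 3 X $ (i, j, k) $ (a, b, c) = X $ (i, k) $ (a, c) * (if j = b then 1 else 0)"
    using sum_mat_units[of "\<lambda>a c d e. X $ (a, d) $ (c, e) * (if j = b then 1 else 0)" i a k c]
    by (simp add: place_def Let_def sum_component mat_scale_nth tensor3_nth mat_def mult_ac)
  show "place 2 3 X $ (i, j, k) $ (a, b, c) = X $ (j, k) $ (b, c) * (if i = a then 1 else 0)"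
    using sum_mat_units[of "\<lambda>b c d e. X $ (b, d) $ (c, e) * (if i = a then 1 else 0)" j b k c]
    by (simp add: place_def Let_def sum_component mat_scale_nth tensor3_nth mat_def mult_ac)
qed

lemma matrix_vector_mult_triple:
  fixes A :: "'n::finite mat_tensor3"
  shows "(A *v f) $ p = (\<Sum>a\<in>UNIV. \<Sum>b\<in>UNIV. \<Sum>c\<in>UNIV. A $ p $ (a, b, c) * f $ (a, b, c))"
  by (simp add: matrix_vector_mult_def sum.cartesian_product case_prod_unfold)

lemma if_mult_indicator: "x * (if P then 1 else 0) * y = (if P then x * y else (0::complex))"
  by simp

text \<open>The remaining index is a spectator: the identity in its position collapses that sum to a
  single term.\<close>

lemma R_leg_mult_nth:
  "(R_leg \<tau> u 1 2 h z w *v f) $ (i, j, k) = R_action \<tau> u h z w i j (\<lambda>a b. f $ (a, b, k))"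
  "(R_leg \<tau> u 1 3 h z w *v f) $ (i, j, k) = R_action \<tau> u h z w i k (\<lambda>a c. f $ (a, j, c))"
  "(R_leg \<tau> u 2 3 h z w *v f) $ (i, j, k) = R_action \<tau> u h z w j k (\<lambda>b c. f $ (i, b, c))"
proof -
  show "(R_leg \<tau> u 1 2 h z w *v f) $ (i, j, k) = R_action \<tau> u h z w i j (\<lambda>a b. f $ (a, b, k))"
    unfolding R_leg_def matrix_vector_mult_triple place_nth if_mult_indicator sum_R_ACF[symmetric]
    by simp
  show "(R_leg \<tau> u 1 3 h z w *v f) $ (i, j, k) = R_action \<tau> u h z w i k (\<lambda>a c. f $ (a, j, c))"
  proof -
    have "(R_leg \<tau> u 1 3 h z w *v f) $ (i, j, k)
      = (\<Sum>a\<in>UNIV. \<Sum>b\<in>UNIV. if j = b then \<Sum>c\<in>UNIV. R_ACF \<tau> u h z w $ (i, k) $ (a, c) * f $ (a, b, c) else 0)"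
      unfolding R_leg_def matrix_vector_mult_triple place_nth if_mult_indicator
      by (intro sum.cong refl) auto
    thus ?thesis by (simp add: sum_R_ACF[symmetric])
  qed
  show "(R_leg \<tau> u 2 3 h z w *v f) $ (i, j, k) = R_action \<tau> u h z w j k (\<lambda>b c. f $ (i, b, c))"
  proof -
    have "(R_leg \<tau> u 2 3 h z w *v f) $ (i, j, k)
      = (\<Sum>a\<in>UNIV. if i = a then \<Sum>b\<in>UNIV. \<Sum>c\<in>UNIV. R_ACF \<tau> u h z w $ (j, k) $ (b, c) * f $ (a, b, c) else 0)"
      unfolding R_leg_def matrix_vector_mult_triple place_nth if_mult_indicator
      by (intro sum.cong refl) auto
    thus ?thesis by (simp add: sum_R_ACF[symmetric])
  qed
qed

lemma R_action_linear:
  "R_action \<tau> u h z w i j (\<lambda>a b. f a b + g a b) = R_action \<tau> u h z w i j f + R_action \<tau> u h z w i j g"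
  "R_action \<tau> u h z w i j (\<lambda>a b. f a b - g a b) = R_action \<tau> u h z w i j f - R_action \<tau> u h z w i j g"
  "R_action \<tau> u h z w i j (\<lambda>a b. - f a b) = - R_action \<tau> u h z w i j f"
  "R_action \<tau> u h z w i j (\<lambda>a b. c * f a b) = c * R_action \<tau> u h z w i j f"
  by (simp_all add: R_action_def algebra_simps)

section \<open>The associative Yang--Baxter equation\<close>

text \<open>These assemble proofs by linear combination: an identity for each column is scaled by
  the value of the function there, the results are added, and what remains is a polynomial identity
  with values of \<phi> and E as atoms.\<close>

lemma scaled: "P = Q \<Longrightarrow> x * P = x * (Q :: complex)"
  and add_scaled: "P = Q \<Longrightarrow> S = T \<Longrightarrow> x * P + S = x * Q + (T :: complex)"
  and eq_if_diff_eq: "S = T \<Longrightarrow> c - d = S - T \<Longrightarrow> c = (d :: complex)"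
  by simp_all

context theta_modulus
begin

text \<open>The form of Fay's identity in which the second arguments are added; off the diagonal
  these are differences of dynamical parameters.\<close>

lemma fay_swapped:
  assumes "t a \<noteq> 0" "t b \<noteq> 0" "t (a + b) \<noteq> 0" "t x \<noteq> 0" "t y \<noteq> 0" "t (x - y) \<noteq> 0"
  shows "\<phi> x a * \<phi> y b = \<phi> (x - y) a * \<phi> y (a + b) + \<phi> (y - x) b * \<phi> x (a + b)"
  using fay[OF assms] by (simp add: phi_commute)

text \<open>\<open>E_sum\<close> at h + (z - w) = (- w) + (z + h). It puts the diagonal coefficient
  of the R-matrix into product form.\<close>

lemma E_sum_product:
  assumes "t h \<noteq> 0" "t (z - w) \<noteq> 0" "t w \<noteq> 0" "t (z + h) \<noteq> 0"
  shows "E h + E (z - w) + E w - E (z + h) = \<phi> h (z - w) * (t z * t (w + h) / (t w * t (z + h)))"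
proof -
  have "t (- w) \<noteq> 0" using assms by (simp add: t_minus)
  hence "E h + E (z - w) - E (- w) - E (z + h)
    = deriv t 0 * t (h + (z - w)) * t (h + w) * t (- z) / (t h * t (z - w) * t (- w) * t (z + h))"
    using E_sum[of h "z - w" "- w" "z + h"] assms by (simp add: algebra_simps)
  thus ?thesis by (simp add: E_minus t_minus kronecker_phi_def mult_ac add.commute)
qed

lemma aybe_action:
  fixes u :: "complex^'n::finite" and F :: "'n \<Rightarrow> 'n \<Rightarrow> 'n \<Rightarrow> complex"
  assumes reg: "R_regular \<tau> u h (z1 + \<eta>) (z2 + \<eta>)" "R_regular \<tau> u \<eta> (z2 + h) (z3 + h)"
    "R_regular \<tau> u \<eta> (z1 + h) (z3 + h)" "R_regular \<tau> u (h - \<eta>) (z1 + \<eta>) (z2 + \<eta>)"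
    "R_regular \<tau> u (\<eta> - h) (z2 + h) (z3 + h)" "R_regular \<tau> u h (z1 + \<eta>) (z3 + \<eta>)"
  shows "R_action \<tau> u h (z1 + \<eta>) (z2 + \<eta>) i j (\<lambda>a b. R_action \<tau> u \<eta> (z2 + h) (z3 + h) b k (\<lambda>b c. F a b c))
    = R_action \<tau> u \<eta> (z1 + h) (z3 + h) i k (\<lambda>a c. R_action \<tau> u (h - \<eta>) (z1 + \<eta>) (z2 + \<eta>) a j (\<lambda>a b. F a b c))
    + R_action \<tau> u (\<eta> - h) (z2 + h) (z3 + h) j k (\<lambda>b c. R_action \<tau> u h (z1 + \<eta>) (z3 + \<eta>) i c (\<lambda>a c. F a b c))"
proof -
  \<comment> \<open>The fully shifted parameters; after rewriting with \<open>eqs\<close>, the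
    shifts by h and \<eta> appear in one normal form.\<close>
  define s1 s2 s3 where "s1 = z1 + h + \<eta>" and "s2 = z2 + h + \<eta>" and "s3 = z3 + h + \<eta>"
  have eqs: "z1 + \<eta> + h = s1" "z2 + \<eta> + h = s2" "z3 + \<eta> + h = s3"
    "z1 + h + \<eta> = s1" "z2 + h + \<eta> = s2" "z3 + h + \<eta> = s3"
    "z1 + \<eta> + (h - \<eta>) = z1 + h" "z2 + \<eta> + (h - \<eta>) = z2 + h" "z3 + \<eta> + (h - \<eta>) = z3 + h"
    "z1 + h + (\<eta> - h) = z1 + \<eta>" "z2 + h + (\<eta> - h) = z2 + \<eta>" "z3 + h + (\<eta> - h) = z3 + \<eta>"
    "z1 + \<eta> - (z2 + \<eta>) = z1 - z2" "z1 + \<eta> - (z3 + \<eta>) = z1 - z3"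
    "z2 + h - (z3 + h) = z2 - z3" "z1 + h - (z3 + h) = z1 - z3"
    by (simp_all add: s1_def s2_def s3_def)
  have nz: "t h \<noteq> 0" "t \<eta> \<noteq> 0" "t (h - \<eta>) \<noteq> 0" "t (\<eta> - h) \<noteq> 0"
    "t (z1 - z2) \<noteq> 0" "t (z2 - z3) \<noteq> 0" "t (z1 - z3) \<noteq> 0"
    "t s1 \<noteq> 0" "t s2 \<noteq> 0" "t (z2 + \<eta>) \<noteq> 0" "t (z3 + h) \<noteq> 0" "t (z1 + h) \<noteq> 0" "t (z3 + \<eta>) \<noteq> 0"
    using reg unfolding R_regular_def eqs by auto
  have nzu: "t (u $ a - u $ b) \<noteq> 0" if "a \<noteq> b" for a b
    using reg(1) that t_diff_commute[of "u $ a" "u $ b"] unfolding R_regular_def by auto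
  have flip: "\<phi> (h - \<eta>) (a - b) = - \<phi> (\<eta> - h) (b - a)" for a b
    using phi_minus[of "h - \<eta>" "a - b"] by simp
  have E_flip: "E (\<eta> - h) = - E (h - \<eta>)"
    using E_minus[of "h - \<eta>"] by simp
  consider "i \<noteq> j" "j \<noteq> k" "i \<noteq> k" | "i = j" "j \<noteq> k" | "i = k" "j \<noteq> k" | "j = k" "i \<noteq> j" | "i = j" "j = k"
    by blast
  thus ?thesis
  proof cases
    case 1
    define x y z where "x = u $ i" and "y = u $ j" and "z = u $ k"
    have u: "u $ i = x" "u $ j = y" "u $ k = z" by (simp_all add: x_def y_def z_def)
    have nz': "t (y - x) \<noteq> 0" "t (x - y) \<noteq> 0" "t (z - y) \<noteq> 0" "t (y - z) \<noteq> 0" "t (z - x) \<noteq> 0" "t (x - z) \<noteq> 0"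
      using nzu[of i j] nzu[of j i] nzu[of j k] nzu[of k j] nzu[of i k] nzu[of k i] 1
      unfolding u by auto
    have c1: "\<phi> h (y - x) * \<phi> \<eta> (z - y)
        = \<phi> (h - \<eta>) (y - x) * \<phi> \<eta> (z - x) + \<phi> (\<eta> - h) (z - y) * \<phi> h (z - x)"
      using fay_swapped[of "y - x" "z - y" h \<eta>] nz nz' by simp
    have c2: "\<phi> (z3 + h) (y - z) * \<phi> (z3 + \<eta>) (x - y)
        = - (\<phi> (\<eta> - h) (z - y) * \<phi> (z3 + \<eta>) (x - z) + \<phi> (h - \<eta>) (y - x) * \<phi> (z3 + h) (x - z))"
      using fay_swapped[of "y - z" "x - y" "z3 + h" "z3 + \<eta>"] nz nz' flip[of y z] flip[of y x] by simp
    have c3: "\<phi> (z2 - z3) (z - y) * \<phi> (z3 + \<eta>) (x - y)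
        = \<phi> (z2 - z3) (z - x) * \<phi> (z2 + \<eta>) (x - y) + \<phi> (z3 + \<eta>) (x - z) * \<phi> (z2 + \<eta>) (z - y)"
      using fay[of "z2 - z3" "z3 + \<eta>" "z - y" "x - y"] nz nz' by simp
    have c4: "\<phi> h (z - x) * \<phi> (z2 + \<eta>) (z - y)
        = \<phi> h (y - x) * \<phi> s2 (z - y) + \<phi> (z2 + \<eta>) (x - y) * \<phi> s2 (z - x)"
      using fay[of h "z2 + \<eta>" "z - x" "z - y"] nz nz' by (simp add: s2_def add_ac)
    have c5: "\<phi> (z1 - z3) (y - x) * \<phi> (z3 + h) (y - z)
        = \<phi> (z1 - z3) (z - x) * \<phi> (z1 + h) (y - z) + \<phi> (z3 + h) (x - z) * \<phi> (z1 + h) (y - x)"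
      using fay[of "z1 - z3" "z3 + h" "y - x" "y - z"] nz nz' by simp
    have c6: "\<phi> \<eta> (z - x) * \<phi> (z1 + h) (y - x)
        = \<phi> \<eta> (z - y) * \<phi> s1 (y - x) + \<phi> (z1 + h) (y - z) * \<phi> s1 (z - x)"
      using fay[of \<eta> "z1 + h" "z - x" "y - x"] nz nz' by (simp add: s1_def add_ac)
    have c7: "\<phi> (z1 - z2) (y - x) * \<phi> (z2 - z3) (z - x)
        = \<phi> (z1 - z2) (y - z) * \<phi> (z1 - z3) (z - x) + \<phi> (z2 - z3) (z - y) * \<phi> (z1 - z3) (y - x)"
      using fay[of "z1 - z2" "z2 - z3" "y - x" "z - x"] nz nz' by simp
    have c8: "\<phi> (z1 - z2) (y - x) * \<phi> s2 (z - x)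
        = \<phi> (z1 - z2) (y - z) * \<phi> s1 (z - x) + \<phi> s2 (z - y) * \<phi> s1 (y - x)"
      using fay[of "z1 - z2" s2 "y - x" "z - x"] nz nz' by (simp add: s2_def s1_def add_ac)
    \<comment> \<open>Each Fay instance is weighted by the value of \<open>F\<close> at its column.
      The remaining columns cancel monomial by monomial, up to \<open>flip\<close>.\<close>
    show ?thesis
      by (rule eq_if_diff_eq[OF add_scaled[where x = "F i j k", OF c1
            add_scaled[where x = "- F i j i", OF c2
            add_scaled[where x = "- F i k i", OF c3
            add_scaled[where x = "F i k k", OF c4
            add_scaled[where x = "- F j j i", OF c5
            add_scaled[where x = "F j j k", OF c6
            add_scaled[where x = "F j k i", OF c7
            scaled[where x = "- F j k k", OF c8]]]]]]]]])
        (use 1 in \<open>simp add: R_action_def u s1_def s2_def s3_def flip[of y z] algebra_simps\<close>)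
  next
    case 2
    define x z where "x = u $ j" and "z = u $ k"
    have u: "u $ j = x" "u $ k = z" by (simp_all add: x_def z_def)
    have nz': "t (z - x) \<noteq> 0" "t (x - z) \<noteq> 0" using nzu 2 unfolding u[symmetric] by auto
    \<comment> \<open>In this and the next two cases, two pairs of arguments with equal sums feed
      \<open>fay_degenerate\<close>, the common sum being the argument on the right up to sign;
      oddness absorbs the signs.\<close>
    have c1: "\<phi> (z1 + h) (x - z) * \<phi> (z1 - z3) (z - x) - \<phi> (\<eta> - h) (z - x) * \<phi> (z3 + \<eta>) (x - z)
        = \<phi> (z3 + h) (x - z) * (E (h - \<eta>) + E (z3 + \<eta>) - E (z1 + h) + E (z1 - z3))"
      using fay_degenerate[of "h - \<eta>" "z3 + \<eta>" "z1 + h" "z3 - z1" "x - z"] nz nz'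
        flip[of x z] t_diff_commute[of z3 z1] E_minus[of "z1 - z3"] phi_minus[of "z1 - z3" "z - x"]
      by (simp add: algebra_simps)
    have c2: "\<phi> s1 (z - x) * \<phi> (z1 + h) (x - z) + \<phi> (\<eta> - h) (z - x) * \<phi> h (z - x)
        = \<phi> \<eta> (z - x) * (E (\<eta> - h) + E h - E s1 + E (z1 + h))"
      using fay_degenerate[of "\<eta> - h" h s1 "- (z1 + h)" "z - x"] nz nz' t_minus[of "z1 + h"]
        E_minus[of "z1 + h"] phi_minus[of "z1 + h" "x - z"]
      by (simp add: s1_def algebra_simps)
    have c3: "\<phi> (z1 - z3) (z - x) * \<phi> (z1 - z2) (x - z) - \<phi> (z2 + \<eta>) (z - x) * \<phi> (z3 + \<eta>) (x - z)
        = \<phi> (z2 - z3) (z - x) * (E (z2 + \<eta>) - E (z3 + \<eta>) - E (z1 - z3) + E (z1 - z2))"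
      using fay_degenerate[of "z2 + \<eta>" "- (z3 + \<eta>)" "z1 - z3" "- (z1 - z2)" "z - x"] nz nz'
        t_minus[of "z3 + \<eta>"] t_minus[of "z1 - z2"] E_minus[of "z3 + \<eta>"] E_minus[of "z1 - z2"]
        phi_minus[of "z3 + \<eta>" "x - z"] phi_minus[of "z1 - z2" "x - z"]
      by (simp add: algebra_simps)
    have c4: "\<phi> s1 (z - x) * \<phi> (z1 - z2) (x - z) + \<phi> (z2 + \<eta>) (z - x) * \<phi> h (z - x)
        = \<phi> s2 (z - x) * (E (z2 + \<eta>) + E h - E s1 + E (z1 - z2))"
      using fay_degenerate[of "z2 + \<eta>" h s1 "- (z1 - z2)" "z - x"] nz nz'
        t_minus[of "z1 - z2"] E_minus[of "z1 - z2"] phi_minus[of "z1 - z2" "x - z"]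
      by (simp add: s1_def s2_def algebra_simps)
    show ?thesis
      by (rule eq_if_diff_eq[OF add_scaled[where x = "F j j j", OF c1
            add_scaled[where x = "- F j j k", OF c2
            add_scaled[where x = "- F j k j", OF c3
            scaled[where x = "F j k k", OF c4]]]]])
        (use 2 in \<open>simp add: R_action_def u s1_def s2_def s3_def flip E_flip algebra_simps\<close>)
  next
    case 3
    define x z where "x = u $ k" and "z = u $ j"
    have u: "u $ k = x" "u $ j = z" by (simp_all add: x_def z_def)
    have nz': "t (z - x) \<noteq> 0" "t (x - z) \<noteq> 0" using nzu 3 unfolding u[symmetric] by auto
    have c1: "\<phi> h (z - x) * \<phi> s2 (x - z) + \<phi> (z2 - z3) (x - z) * \<phi> (z3 + \<eta>) (x - z)
        = \<phi> (z2 + \<eta>) (x - z) * (E (z2 - z3) + E (z3 + \<eta>) - E s2 + E h)"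
      using fay_degenerate[of "z2 - z3" "z3 + \<eta>" s2 "- h" "x - z"] nz nz'
        t_minus[of h] E_minus[of h] phi_minus[of h "z - x"]
      by (simp add: s2_def algebra_simps)
    have c2: "\<phi> h (z - x) * \<phi> \<eta> (x - z) - \<phi> (z3 + h) (z - x) * \<phi> (z3 + \<eta>) (x - z)
        = \<phi> (h - \<eta>) (z - x) * (E (z3 + h) - E (z3 + \<eta>) - E h + E \<eta>)"
      using fay_degenerate[of "z3 + h" "- (z3 + \<eta>)" h "- \<eta>" "z - x"] nz nz'
        t_minus[of "z3 + \<eta>"] t_minus[of \<eta>] E_minus[of "z3 + \<eta>"] E_minus[of \<eta>]
        phi_minus[of "z3 + \<eta>" "x - z"] phi_minus[of \<eta> "x - z"]
      by (simp add: algebra_simps)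
    have c3: "\<phi> s1 (z - x) * \<phi> s2 (x - z) - \<phi> (z2 - z3) (x - z) * \<phi> (z1 - z3) (z - x)
        = \<phi> (z1 - z2) (z - x) * (E (z1 - z3) - E (z2 - z3) - E s1 + E s2)"
      using fay_degenerate[of "z1 - z3" "- (z2 - z3)" s1 "- s2" "z - x"] nz nz'
        t_minus[of "z2 - z3"] t_minus[of s2] E_minus[of "z2 - z3"] E_minus[of s2]
        phi_minus[of "z2 - z3" "x - z"] phi_minus[of s2 "x - z"]
      by (simp add: s1_def s2_def algebra_simps)
    have c4: "\<phi> s1 (z - x) * \<phi> \<eta> (x - z) + \<phi> (z3 + h) (z - x) * \<phi> (z1 - z3) (z - x)
        = \<phi> (z1 + h) (z - x) * (E (z3 + h) + E (z1 - z3) - E s1 + E \<eta>)"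
      using fay_degenerate[of "z3 + h" "z1 - z3" s1 "- \<eta>" "z - x"] nz nz'
        t_minus[of \<eta>] E_minus[of \<eta>] phi_minus[of \<eta> "x - z"]
      by (simp add: s1_def algebra_simps)
    show ?thesis
      by (rule eq_if_diff_eq[OF add_scaled[where x = "- F k k k", OF c1
            add_scaled[where x = "F k j k", OF c2
            add_scaled[where x = "F j k k", OF c3
            scaled[where x = "- F j j k", OF c4]]]]])
        (use 3 in \<open>simp add: R_action_def u s1_def s2_def s3_def flip E_flip algebra_simps\<close>)
  next
    case 4
    define x z where "x = u $ k" and "z = u $ i"
    have u: "u $ k = x" "u $ i = z" by (simp_all add: x_def z_def)
    have nz': "t (z - x) \<noteq> 0" "t (x - z) \<noteq> 0" using nzu 4 unfolding u[symmetric] by auto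
    have c1: "\<phi> (z1 - z2) (x - z) * \<phi> s2 (x - z) - \<phi> \<eta> (x - z) * \<phi> (z1 + h) (x - z)
        = \<phi> s1 (x - z) * (E (z1 - z2) + E s2 - E \<eta> - E (z1 + h))"
      using fay_degenerate[of "z1 - z2" s2 \<eta> "z1 + h" "x - z"] nz nz'
      by (simp add: s1_def s2_def algebra_simps)
    have c2: "\<phi> (z1 - z2) (x - z) * \<phi> (z2 - z3) (x - z) + \<phi> (z3 + h) (z - x) * \<phi> (z1 + h) (x - z)
        = \<phi> (z1 - z3) (x - z) * (E (z1 - z2) + E (z2 - z3) - E (z1 + h) + E (z3 + h))"
      using fay_degenerate[of "z1 - z2" "z2 - z3" "z1 + h" "- (z3 + h)" "x - z"] nz nz'
        t_minus[of "z3 + h"] E_minus[of "z3 + h"] phi_minus[of "z3 + h" "z - x"]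
      by (simp add: algebra_simps)
    have c3: "\<phi> (z2 + \<eta>) (z - x) * \<phi> s2 (x - z) + \<phi> \<eta> (x - z) * \<phi> (h - \<eta>) (x - z)
        = \<phi> h (x - z) * (E \<eta> + E (h - \<eta>) - E s2 + E (z2 + \<eta>))"
      using fay_degenerate[of \<eta> "h - \<eta>" s2 "- (z2 + \<eta>)" "x - z"] nz nz'
        t_minus[of "z2 + \<eta>"] E_minus[of "z2 + \<eta>"] phi_minus[of "z2 + \<eta>" "z - x"]
      by (simp add: s2_def algebra_simps)
    have c4: "\<phi> (z2 + \<eta>) (z - x) * \<phi> (z2 - z3) (x - z) + \<phi> (z3 + h) (z - x) * \<phi> (\<eta> - h) (z - x)
        = \<phi> (z3 + \<eta>) (z - x) * (E (z3 + h) + E (\<eta> - h) - E (z2 + \<eta>) + E (z2 - z3))"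
      using fay_degenerate[of "z3 + h" "\<eta> - h" "z2 + \<eta>" "- (z2 - z3)" "z - x"] nz nz'
        t_minus[of "z2 - z3"] E_minus[of "z2 - z3"] phi_minus[of "z2 - z3" "x - z"]
      by (simp add: algebra_simps)
    show ?thesis
      by (rule eq_if_diff_eq[OF add_scaled[where x = "- F k k k", OF c1
            add_scaled[where x = "F k k i", OF c2
            add_scaled[where x = "- F i k k", OF c3
            scaled[where x = "F i k i", OF c4]]]]])
        (use 4 in \<open>simp add: R_action_def u s1_def s2_def s3_def E_flip flip algebra_simps\<close>)
  next
    case 5
    \<comment> \<open>The theta quotients from \<open>E_sum_product\<close> telescope to this same
      factor in all three products, which leaves Fay's identity.\<close>
    define K where "K = t (z1 + \<eta>) * t (z2 + h) * t s3 / (t (z2 + \<eta>) * t s1 * t (z3 + h))"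
    have "\<phi> h (z1 - z2) * \<phi> \<eta> (z2 - z3)
        = \<phi> (h - \<eta>) (z1 - z2) * \<phi> \<eta> (z1 - z3) + \<phi> (\<eta> - h) (z2 - z3) * \<phi> h (z1 - z3)"
      using fay_swapped[of "z1 - z2" "z2 - z3" h \<eta>] nz by simp
    hence fay_K: "\<phi> h (z1 - z2) * \<phi> \<eta> (z2 - z3) * (K * c)
        = \<phi> \<eta> (z1 - z3) * \<phi> (h - \<eta>) (z1 - z2) * (K * c)
        + \<phi> (\<eta> - h) (z2 - z3) * \<phi> h (z1 - z3) * (K * c)" for c
      by (simp add: distrib_right)
    have e1: "E h + E (z1 - z2) + E (z2 + \<eta>) - E s1 = \<phi> h (z1 - z2) * (t (z1 + \<eta>) * t s2 / (t (z2 + \<eta>) * t s1))"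
      using E_sum_product[of "h" "z1 + \<eta>" "z2 + \<eta>"] nz unfolding eqs by blast
    have e2: "E \<eta> + E (z2 - z3) + E (z3 + h) - E s2 = \<phi> \<eta> (z2 - z3) * (t (z2 + h) * t s3 / (t (z3 + h) * t s2))"
      using E_sum_product[of "\<eta>" "z2 + h" "z3 + h"] nz unfolding eqs by blast
    have e3: "E \<eta> + E (z1 - z3) + E (z3 + h) - E s1 = \<phi> \<eta> (z1 - z3) * (t (z1 + h) * t s3 / (t (z3 + h) * t s1))"
      using E_sum_product[of "\<eta>" "z1 + h" "z3 + h"] nz unfolding eqs by blast
    have e4: "E (h - \<eta>) + E (z1 - z2) + E (z2 + \<eta>) - E (z1 + h) = \<phi> (h - \<eta>) (z1 - z2) * (t (z1 + \<eta>) * t (z2 + h) / (t (z2 + \<eta>) * t (z1 + h)))"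
      using E_sum_product[of "h - \<eta>" "z1 + \<eta>" "z2 + \<eta>"] nz unfolding eqs by blast
    have e5: "E (\<eta> - h) + E (z2 - z3) + E (z3 + h) - E (z2 + \<eta>) = \<phi> (\<eta> - h) (z2 - z3) * (t (z2 + h) * t (z3 + \<eta>) / (t (z3 + h) * t (z2 + \<eta>)))"
      using E_sum_product[of "\<eta> - h" "z2 + h" "z3 + h"] nz unfolding eqs by blast
    have e6: "E h + E (z1 - z3) + E (z3 + \<eta>) - E s1 = \<phi> h (z1 - z3) * (t (z1 + \<eta>) * t s3 / (t (z3 + \<eta>) * t s1))"
      using E_sum_product[of "h" "z1 + \<eta>" "z3 + \<eta>"] nz unfolding eqs by blast
    have k1: "\<phi> h (z1 - z2) * (t (z1 + \<eta>) * t s2 / (t (z2 + \<eta>) * t s1))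
          * (\<phi> \<eta> (z2 - z3) * (t (z2 + h) * t s3 / (t (z3 + h) * t s2)) * c)
        = \<phi> h (z1 - z2) * \<phi> \<eta> (z2 - z3) * (K * c)" for c
      using nz by (simp add: K_def mult_ac)
    have k2: "\<phi> \<eta> (z1 - z3) * (t (z1 + h) * t s3 / (t (z3 + h) * t s1))
          * (\<phi> (h - \<eta>) (z1 - z2) * (t (z1 + \<eta>) * t (z2 + h) / (t (z2 + \<eta>) * t (z1 + h))) * c)
        = \<phi> \<eta> (z1 - z3) * \<phi> (h - \<eta>) (z1 - z2) * (K * c)" for c
      using nz by (simp add: K_def mult_ac)
    have k3: "\<phi> (\<eta> - h) (z2 - z3) * (t (z2 + h) * t (z3 + \<eta>) / (t (z3 + h) * t (z2 + \<eta>)))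
          * (\<phi> h (z1 - z3) * (t (z1 + \<eta>) * t s3 / (t (z3 + \<eta>) * t s1)) * c)
        = \<phi> (\<eta> - h) (z2 - z3) * \<phi> h (z1 - z3) * (K * c)" for c
      using nz by (simp add: K_def mult_ac)
    show ?thesis
      using 5 fay_K[of "F k k k"] by (simp only: R_action_def eqs if_True e1 e2 e3 e4 e5 e6 k1 k2 k3 refl)
  qed
qed

section \<open>Unitarity and the cubic identity\<close>

text \<open>Off the diagonal, \<open>c1\<close> gives the scalar at \<open>g i j\<close>,
  \<open>c3\<close> and \<open>c4\<close> cancel the columns (j, j) and (i, i), and oddness cancels
  (j, i). On the diagonal the two theta quotients are reciprocal.\<close>

lemma unitarity_action:
  fixes u :: "complex^'n::finite"
  assumes reg: "R_regular \<tau> u h z w" "R_regular \<tau> u (- h) (z + h) (w + h)"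
  shows "R_action \<tau> u h z w i j (\<lambda>a b. R_action \<tau> u (- h) (z + h) (w + h) a b g)
    = (weierstrass_p \<tau> (z - w) - weierstrass_p \<tau> h) * g i j"
proof -
  have nz: "t h \<noteq> 0" "t (- h) \<noteq> 0" "t (z - w) \<noteq> 0" "t (w - z) \<noteq> 0" "t w \<noteq> 0" "t (z + h) \<noteq> 0" "t z \<noteq> 0" "t (w + h) \<noteq> 0"
    using reg t_diff_commute[of z w] unfolding R_regular_def by auto
  show ?thesis
  proof (cases "i = j")
    case False
    define X where "X = u $ j - u $ i"
    have u: "u $ j - u $ i = X" "u $ i - u $ j = - X" by (simp_all add: X_def)
    have nz': "t X \<noteq> 0" "t (- X) \<noteq> 0"
      using reg(1) False unfolding R_regular_def X_def by (auto simp: t_minus[of "u $ j - u $ i", simplified])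
    have c1: "\<phi> h X * \<phi> (- h) X + \<phi> (z - w) X * \<phi> (z - w) (- X)
       = weierstrass_p \<tau> (z - w) - weierstrass_p \<tau> h"
      using phi_phi_minus[of h X] phi_phi_minus[of "z - w" X] nz nz' phi_minus[of "z - w" "- X"] by (simp add: algebra_simps)
    have c2: "\<phi> (- h) (- X) = - \<phi> h X"
      by (rule phi_minus)
    have c3: "\<phi> (z - w) X * \<phi> (w + h) X - \<phi> h X * \<phi> z X
      = \<phi> (z + h) X * (E (z - w) + E (w + h) - E h - E z)"
      using fay_degenerate[of "z - w" "w + h" h z X] nz nz' by (simp add: add.commute)
    have c4: "\<phi> h X * \<phi> (w + h) (- X) - \<phi> (z - w) X * \<phi> z (- X)
      = \<phi> w (- X) * (E z - E (z - w) + E h - E (w + h))"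
      using fay_degenerate[of "- h" "w + h" "w - z" z "- X"] nz nz' phi_minus[of h X] phi_minus[of "z - w" X]
        E_minus[of h] E_minus[of "z - w"] by (simp add: algebra_simps)
    show ?thesis
      by (rule eq_if_diff_eq[OF add_scaled[where x = "g i j", OF c1
            add_scaled[where x = "g j j", OF c3
            add_scaled[where x = "g i i", OF c4
            scaled[where x = "g j i * \<phi> (z - w) X", OF c2]]]]])
        (use False in \<open>simp add: R_action_def u E_minus[of h] algebra_simps\<close>)
  next
    case True
    have "E h + E (z - w) + E w - E (z + h) = \<phi> h (z - w) * (t z * t (w + h) / (t w * t (z + h)))"
      using E_sum_product[of h z w] nz by simp
    moreover have "E (- h) + E (z - w) + E (w + h) - E z
       = \<phi> (- h) (z - w) * (t (z + h) * t w / (t (w + h) * t z))"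
      using E_sum_product[of "- h" "z + h" "w + h"] nz by simp
    ultimately have "(E h + E (z - w) + E w - E (z + h)) * (E (- h) + E (z - w) + E (w + h) - E z)
      = \<phi> h (z - w) * \<phi> (- h) (z - w)"
      using nz by simp
    also have "\<dots> = weierstrass_p \<tau> (z - w) - weierstrass_p \<tau> h"
      using phi_phi_minus nz by simp
    finally show ?thesis
      using True by (simp add: R_action_def mult.assoc[symmetric])
  qed
qed

section \<open>Skew-symmetry and the cubic identity at generic points\<close>

text \<open>\<phi> changes sign when both arguments do. The shift by h makes the coefficients with
  arguments z + h and w trade places when the two factors are exchanged.\<close>

lemma R_action_skew:
  "R_action \<tau> u (- h) (w + h) (z + h) j i (\<lambda>b a. g a b) = - R_action \<tau> u h z w i j g"
  using phi_minus[of h "u $ j - u $ i"] phi_minus[of "z - w" "u $ j - u $ i"]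
    phi_minus[of w "u $ i - u $ j"] phi_minus[of "z + h" "u $ j - u $ i"]
    E_minus[of h] E_minus[of "z - w"] E_minus[of w] E_minus[of "z + h"]
    phi_minus[of "w + h" "u $ j - u $ i"]
  by (simp add: R_action_def algebra_simps)

lemma R_regular_skew: "R_regular \<tau> u (- h) (w + h) (z + h) \<longleftrightarrow> R_regular \<tau> u h z w"
  using t_diff_commute[of w z] t_minus[of h] by (auto simp: R_regular_def)

lemma wp_minus:
  assumes "t h \<noteq> 0"
  shows "weierstrass_p \<tau> (- h) = weierstrass_p \<tau> h"
  using wp_diff[of "- h" h] assms by (simp add: t_minus t_0)

text \<open>The associative equation with positions 2 and 3 exchanged, \<eta> negated and each z
  replaced by z - h + \<eta>; skew-symmetry turns the legs (3, 2) back into (2, 3).\<close>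

lemma aybe_action_swapped:
  fixes u :: "complex^'n::finite" and F :: "'n \<Rightarrow> 'n \<Rightarrow> 'n \<Rightarrow> complex"
  assumes reg: "R_regular \<tau> u h (z1 - h) (z3 - h)" "R_regular \<tau> u \<eta> z2 z3"
    "R_regular \<tau> u (h + \<eta>) (z2 - h) (z3 - h)" "R_regular \<tau> u h (z1 - h) (z2 - h)"
    "R_regular \<tau> u (- \<eta>) (z1 + \<eta>) (z2 + \<eta>)" "R_regular \<tau> u (h + \<eta>) (z1 - h) (z3 - h)"
  shows "R_action \<tau> u h (z1 - h) (z3 - h) i k (\<lambda>a c. R_action \<tau> u \<eta> z2 z3 j c (\<lambda>b c. F a b c))
    = R_action \<tau> u (h + \<eta>) (z2 - h) (z3 - h) j k (\<lambda>b c. R_action \<tau> u h (z1 - h) (z2 - h) i b (\<lambda>a b. F a b c))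
    - R_action \<tau> u (- \<eta>) (z1 + \<eta>) (z2 + \<eta>) i j (\<lambda>a b. R_action \<tau> u (h + \<eta>) (z1 - h) (z3 - h) a k (\<lambda>a c. F a b c))"
proof -
  have eqs: "z1 - h + \<eta> + - \<eta> = z1 - h" "z2 - h + \<eta> + - \<eta> = z2 - h" "z3 - h + \<eta> + - \<eta> = z3 - h"
    "z1 - h + \<eta> + h = z1 + \<eta>" "z2 - h + \<eta> + h = z2 + \<eta>" "z3 - h + \<eta> + h = z3 + \<eta>"
    "h - - \<eta> = h + \<eta>" "- \<eta> - h = - (h + \<eta>)"
    by simp_all
  have shift: "z2 - h + (h + \<eta>) = z2 + \<eta>" "z3 - h + (h + \<eta>) = z3 + \<eta>" by simp_all
  note reg32 = R_regular_skew[of u \<eta> z3 z2] R_regular_skew[of u "h + \<eta>" "z3 - h" "z2 - h", unfolded shift]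
  note skew32 = R_action_skew[of u \<eta> z3 z2] R_action_skew[of u "h + \<eta>" "z3 - h" "z2 - h", unfolded shift]
  show ?thesis
    using aybe_action[of u h "z1 - h + \<eta>" "- \<eta>" "z3 - h + \<eta>" "z2 - h + \<eta>" i k j "\<lambda>a c b. F a b c"]
    unfolding eqs reg32 skew32 R_action_linear using reg by (simp add: algebra_simps)
qed

lemma cubic_action_generic:
  fixes u :: "complex^'n::finite" and F :: "'n \<Rightarrow> 'n \<Rightarrow> 'n \<Rightarrow> complex"
  assumes reg: "R_regular \<tau> u \<eta> z1 z2" "R_regular \<tau> u h (z1 - h) (z3 - h)"
    "R_regular \<tau> u \<eta> z2 z3" "R_regular \<tau> u h (z2 - h) (z3 - h)"
    "R_regular \<tau> u \<eta> z1 z3" "R_regular \<tau> u h (z1 - h) (z2 - h)"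
    "R_regular \<tau> u (h + \<eta>) (z1 - h) (z3 - h)"
    and generic: "t (z1 - h) \<noteq> 0"
  shows "R_action \<tau> u \<eta> z1 z2 i j (\<lambda>a b. R_action \<tau> u h (z1 - h) (z3 - h) a k
            (\<lambda>a c. R_action \<tau> u \<eta> z2 z3 b c (\<lambda>b c. F a b c)))
       - R_action \<tau> u h (z2 - h) (z3 - h) j k (\<lambda>b c. R_action \<tau> u \<eta> z1 z3 i c
            (\<lambda>a c. R_action \<tau> u h (z1 - h) (z2 - h) a b (\<lambda>a b. F a b c)))
    = (weierstrass_p \<tau> \<eta> - weierstrass_p \<tau> h) * R_action \<tau> u (h + \<eta>) (z1 - h) (z3 - h) i k (\<lambda>a c. F a j c)"
    (is "?A - ?B = _ * ?C")
proof -
  have eqs: "z1 - h - \<eta> + (h + \<eta>) = z1" "z2 - h - \<eta> + (h + \<eta>) = z2" "z3 - h - \<eta> + (h + \<eta>) = z3"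
    "z1 - h - \<eta> + \<eta> = z1 - h" "z2 - h - \<eta> + \<eta> = z2 - h" "z3 - h - \<eta> + \<eta> = z3 - h"
    "\<eta> - (h + \<eta>) = - h" "h + \<eta> - \<eta> = h"
    by simp_all
  have regs: "R_regular \<tau> u (h + \<eta>) (z2 - h) (z3 - h)" "R_regular \<tau> u (- \<eta>) (z1 + \<eta>) (z2 + \<eta>)"
    "R_regular \<tau> u (- h) z1 z2"
    using reg generic by (auto simp: R_regular_def t_minus algebra_simps)
  have "?A = R_action \<tau> u \<eta> z1 z2 i j (\<lambda>a b. R_action \<tau> u (h + \<eta>) (z2 - h) (z3 - h) b k
        (\<lambda>b c. R_action \<tau> u h (z1 - h) (z2 - h) a b (\<lambda>a b. F a b c)))
      - R_action \<tau> u \<eta> z1 z2 i j (\<lambda>a b. R_action \<tau> u (- \<eta>) (z1 + \<eta>) (z2 + \<eta>) a b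
        (\<lambda>a b. R_action \<tau> u (h + \<eta>) (z1 - h) (z3 - h) a k (\<lambda>a c. F a b c)))"
    by (subst aybe_action_swapped) (use reg regs in \<open>simp_all add: R_action_linear\<close>)
  also have "R_action \<tau> u \<eta> z1 z2 i j (\<lambda>a b. R_action \<tau> u (h + \<eta>) (z2 - h) (z3 - h) b k
        (\<lambda>b c. R_action \<tau> u h (z1 - h) (z2 - h) a b (\<lambda>a b. F a b c)))
    = R_action \<tau> u (h + \<eta>) (z1 - h) (z3 - h) i k (\<lambda>a c. R_action \<tau> u (- h) z1 z2 a j
        (\<lambda>a b. R_action \<tau> u h (z1 - h) (z2 - h) a b (\<lambda>a b. F a b c))) + ?B"
    \<comment> \<open>The parameters (h, \<eta>) become (\<eta>, h + \<eta>), with each z lowered by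
      h + \<eta> to restore the spectral arguments. The second term on the right is
      \<open>?B\<close>.\<close>
    using aybe_action[of u \<eta> "z1 - h - \<eta>" "h + \<eta>" "z2 - h - \<eta>" "z3 - h - \<eta>" i j k
        "\<lambda>a b c. R_action \<tau> u h (z1 - h) (z2 - h) a b (\<lambda>a b. F a b c)"] reg regs
    unfolding eqs by simp
  also have "R_action \<tau> u (h + \<eta>) (z1 - h) (z3 - h) i k (\<lambda>a c. R_action \<tau> u (- h) z1 z2 a j
        (\<lambda>a b. R_action \<tau> u h (z1 - h) (z2 - h) a b (\<lambda>a b. F a b c)))
      = (weierstrass_p \<tau> (z1 - z2) - weierstrass_p \<tau> h) * ?C"
  proof -
    have "R_action \<tau> u (- h) z1 z2 a j (\<lambda>a b. R_action \<tau> u h (z1 - h) (z2 - h) a b g)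
       = (weierstrass_p \<tau> (z1 - z2) - weierstrass_p \<tau> h) * g a j" for a g
      using unitarity_action[of u "- h" z1 z2 a j g] regs(3) reg(6) wp_minus[of h]
      by (simp add: R_regular_def)
    thus ?thesis by (simp add: R_action_linear)
  qed
  also have "R_action \<tau> u \<eta> z1 z2 i j (\<lambda>a b. R_action \<tau> u (- \<eta>) (z1 + \<eta>) (z2 + \<eta>) a b
        (\<lambda>a b. R_action \<tau> u (h + \<eta>) (z1 - h) (z3 - h) a k (\<lambda>a c. F a b c)))
      = (weierstrass_p \<tau> (z1 - z2) - weierstrass_p \<tau> \<eta>) * ?C"
    by (rule unitarity_action[OF reg(1) regs(2)])
  finally show ?thesis by (simp add: algebra_simps)
qed

section \<open>Continuity in the spectral parameter\<close>

lemma isCont_E: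
  assumes "isCont g p" "t (g p) \<noteq> 0"
  shows "isCont (\<lambda>s. E (g s)) p"
  using isCont_o2[OF assms(1) DERIV_isCont[OF E_DERIV[OF assms(2)]]] .

lemma isCont_phi:
  assumes "isCont g p" "t (g p) \<noteq> 0" "t x \<noteq> 0"
  shows "isCont (\<lambda>s. \<phi> (g s) x) p"
proof -
  have "isCont (\<lambda>s. t (g s + x)) p" "isCont (\<lambda>s. t (g s)) p"
    by (intro isCont_o2[OF _ isCont_t] continuous_intros assms)+
  thus ?thesis unfolding kronecker_phi_def using assms by (intro continuous_intros) auto
qed

text \<open>The function acted on may vary with s as well, so the rule applies to nested
  actions.\<close>

lemma isCont_R_action:
  assumes cont: "isCont z p" "isCont w p" "\<And>a b. isCont (\<lambda>s. g s a b) p"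
    and reg: "R_regular \<tau> u h (z p) (w p)"
  shows "isCont (\<lambda>s. R_action \<tau> u h (z s) (w s) i j (g s)) p"
proof (cases "i = j")
  case True
  have "t h \<noteq> 0" "t (z p - w p) \<noteq> 0" "t (w p) \<noteq> 0" "t (z p + h) \<noteq> 0"
    using reg by (simp_all add: R_regular_def)
  thus ?thesis
    using True unfolding R_action_def by (auto intro!: continuous_intros isCont_E cont)
next
  case False
  have "t (u $ i - u $ j) \<noteq> 0" "t (u $ j - u $ i) \<noteq> 0"
    using reg False t_diff_commute[of "u $ i" "u $ j"] unfolding R_regular_def by auto
  moreover have "t h \<noteq> 0" "t (z p - w p) \<noteq> 0" "t (w p) \<noteq> 0" "t (z p + h) \<noteq> 0"
    using reg by (simp_all add: R_regular_def)
  ultimately show ?thesis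
    using False unfolding R_action_def by (auto intro!: continuous_intros isCont_phi cont)
qed

lemma eventually_t_nonzero:
  assumes "isCont g p" "t (g p) \<noteq> 0"
  shows "\<forall>\<^sub>F s in at p. t (g s) \<noteq> 0"
  using isCont_o2[OF assms(1) isCont_t] assms(2) unfolding isCont_def by (rule tendsto_imp_eventually_ne)

lemma eventually_R_regular:
  assumes "isCont z p" "isCont w p" "R_regular \<tau> u h (z p) (w p)"
  shows "\<forall>\<^sub>F s in at p. R_regular \<tau> u h (z s) (w s)"
proof -
  have "\<forall>\<^sub>F s in at p. t (z s - w s) \<noteq> 0" "\<forall>\<^sub>F s in at p. t (z s + h) \<noteq> 0" "\<forall>\<^sub>F s in at p. t (w s) \<noteq> 0"
    using assms unfolding R_regular_def by (auto intro!: eventually_t_nonzero continuous_intros)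
  thus ?thesis
    by eventually_elim (use assms(3) in \<open>simp add: R_regular_def\<close>)
qed

text \<open>Zeros of theta are isolated: it is entire, and its value at h shows that it is not
  identically zero.\<close>

lemma eventually_t_shift_nonzero:
  assumes "t h \<noteq> 0"
  shows "\<forall>\<^sub>F s in at p. t (s - h) \<noteq> 0"
proof (cases "t (p - h) = 0")
  case True
  obtain r where "r > 0" and r: "\<And>z. z \<in> ball (p - h) r - {p - h} \<Longrightarrow> t z \<noteq> 0"
    using isolated_zeros[OF odd_theta_holomorphic[OF Im_pos], of "p - h" h] True assms by auto
  have "t (s - h) \<noteq> 0" if "s \<noteq> p" "dist s p < r" for s
    using that by (intro r) (auto simp: dist_norm norm_minus_commute)
  thus ?thesis using \<open>r > 0\<close> unfolding eventually_at by auto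
qed (auto intro!: eventually_t_nonzero continuous_intros)

text \<open>The regularity hypotheses do not exclude \<open>\<theta> (z1 - h) = 0\<close>, which the unitarity step of the
  generic case does; that locus is reached by continuity in \<open>z1\<close>.\<close>

lemma cubic_action:
  fixes u :: "complex^'n::finite" and F :: "'n \<Rightarrow> 'n \<Rightarrow> 'n \<Rightarrow> complex"
  assumes reg: "R_regular \<tau> u \<eta> z1 z2" "R_regular \<tau> u h (z1 - h) (z3 - h)"
    "R_regular \<tau> u \<eta> z2 z3" "R_regular \<tau> u h (z2 - h) (z3 - h)"
    "R_regular \<tau> u \<eta> z1 z3" "R_regular \<tau> u h (z1 - h) (z2 - h)"
    "R_regular \<tau> u (h + \<eta>) (z1 - h) (z3 - h)"
  shows "R_action \<tau> u \<eta> z1 z2 i j (\<lambda>a b. R_action \<tau> u h (z1 - h) (z3 - h) a k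
            (\<lambda>a c. R_action \<tau> u \<eta> z2 z3 b c (\<lambda>b c. F a b c)))
       - R_action \<tau> u h (z2 - h) (z3 - h) j k (\<lambda>b c. R_action \<tau> u \<eta> z1 z3 i c
            (\<lambda>a c. R_action \<tau> u h (z1 - h) (z2 - h) a b (\<lambda>a b. F a b c)))
    = (weierstrass_p \<tau> \<eta> - weierstrass_p \<tau> h) * R_action \<tau> u (h + \<eta>) (z1 - h) (z3 - h) i k (\<lambda>a c. F a j c)"
proof -
  \<comment> \<open>The difference of the two sides as a function of the first spectral parameter:
    continuous at z1 and zero on a punctured neighbourhood.\<close>
  define D where "D s = R_action \<tau> u \<eta> s z2 i j (\<lambda>a b. R_action \<tau> u h (s - h) (z3 - h) a k
            (\<lambda>a c. R_action \<tau> u \<eta> z2 z3 b c (\<lambda>b c. F a b c)))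
       - R_action \<tau> u h (z2 - h) (z3 - h) j k (\<lambda>b c. R_action \<tau> u \<eta> s z3 i c
            (\<lambda>a c. R_action \<tau> u h (s - h) (z2 - h) a b (\<lambda>a b. F a b c)))
       - (weierstrass_p \<tau> \<eta> - weierstrass_p \<tau> h) * R_action \<tau> u (h + \<eta>) (s - h) (z3 - h) i k (\<lambda>a c. F a j c)" for s
  have "isCont D z1"
    unfolding D_def by (intro continuous_intros isCont_R_action reg)
  hence "D \<midarrow>z1\<rightarrow> D z1" by (simp add: isCont_def)
  moreover have "\<forall>\<^sub>F s in at z1. D s = 0"
  proof -
    have "t h \<noteq> 0" using reg(2) by (simp add: R_regular_def)
    hence "\<forall>\<^sub>F s in at z1. t (s - h) \<noteq> 0" by (rule eventually_t_shift_nonzero)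
    moreover have "\<forall>\<^sub>F s in at z1. R_regular \<tau> u \<eta> s z2" "\<forall>\<^sub>F s in at z1. R_regular \<tau> u h (s - h) (z3 - h)"
      "\<forall>\<^sub>F s in at z1. R_regular \<tau> u \<eta> s z3" "\<forall>\<^sub>F s in at z1. R_regular \<tau> u h (s - h) (z2 - h)"
      "\<forall>\<^sub>F s in at z1. R_regular \<tau> u (h + \<eta>) (s - h) (z3 - h)"
      by (intro eventually_R_regular continuous_intros reg)+
    ultimately show ?thesis
    proof eventually_elim
      case (elim s)
      show ?case
        unfolding D_def by (subst cubic_action_generic) (use elim reg in auto)
    qed
  qed
  hence "D \<midarrow>z1\<rightarrow> 0" by (simp add: tendsto_eventually)
  ultimately have "D z1 = 0" by (rule LIM_unique)
  thus ?thesis unfolding D_def by simp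
qed

end

section \<open>From row functionals back to matrices\<close>

lemma matrix_eqI_mult: "(\<And>f. A *v f = B *v f) \<Longrightarrow> A = (B :: complex^'c::finite^'r)"
  by (simp add: matrix_eq)

lemma mat_scale_mult: "(c *\<^sub>m A) *v f = (\<chi> p. c * (A *v f) $ p)"
  by (simp add: vec_eq_iff matrix_vector_mult_def mat_scale_nth sum_distrib_left mult.assoc)

theorem theorem1:
  fixes \<tau> h \<eta> z1 z2 z3 :: complex
    and u :: "complex^('n::finite)"
  assumes "Im \<tau> > 0"
  shows
    "(R_regular \<tau> u h (z1 + \<eta>) (z2 + \<eta>) \<and> R_regular \<tau> u \<eta> (z2 + h) (z3 + h) \<and>
      R_regular \<tau> u \<eta> (z1 + h) (z3 + h) \<and> R_regular \<tau> u (h - \<eta>) (z1 + \<eta>) (z2 + \<eta>) \<and>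
      R_regular \<tau> u (\<eta> - h) (z2 + h) (z3 + h) \<and> R_regular \<tau> u h (z1 + \<eta>) (z3 + \<eta>) \<longrightarrow>
        R_leg \<tau> u 1 2 h (z1 + \<eta>) (z2 + \<eta>) ** R_leg \<tau> u 2 3 \<eta> (z2 + h) (z3 + h)
        = R_leg \<tau> u 1 3 \<eta> (z1 + h) (z3 + h) ** R_leg \<tau> u 1 2 (h - \<eta>) (z1 + \<eta>) (z2 + \<eta>)
          + R_leg \<tau> u 2 3 (\<eta> - h) (z2 + h) (z3 + h) ** R_leg \<tau> u 1 3 h (z1 + \<eta>) (z3 + \<eta>))
     \<and>
     (R_regular \<tau> u \<eta> z1 z2 \<and> R_regular \<tau> u h (z1 - h) (z3 - h) \<and>
      R_regular \<tau> u \<eta> z2 z3 \<and> R_regular \<tau> u h (z2 - h) (z3 - h) \<and>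
      R_regular \<tau> u \<eta> z1 z3 \<and> R_regular \<tau> u h (z1 - h) (z2 - h) \<and>
      R_regular \<tau> u (h + \<eta>) (z1 - h) (z3 - h) \<longrightarrow>
        R_leg \<tau> u 1 2 \<eta> z1 z2 ** R_leg \<tau> u 1 3 h (z1 - h) (z3 - h) ** R_leg \<tau> u 2 3 \<eta> z2 z3
        - R_leg \<tau> u 2 3 h (z2 - h) (z3 - h) ** R_leg \<tau> u 1 3 \<eta> z1 z3
            ** R_leg \<tau> u 1 2 h (z1 - h) (z2 - h)
        = (weierstrass_p \<tau> \<eta> - weierstrass_p \<tau> h)
            *\<^sub>m R_leg \<tau> u 1 3 (h + \<eta>) (z1 - h) (z3 - h))"
proof -
  interpret theta_modulus \<tau> by standard (rule assms)
  show ?thesis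
  proof (intro conjI impI; elim conjE; intro matrix_eqI_mult)
    fix f :: "complex^('n \<times> 'n \<times> 'n)"
    assume reg: "R_regular \<tau> u h (z1 + \<eta>) (z2 + \<eta>)" "R_regular \<tau> u \<eta> (z2 + h) (z3 + h)"
      "R_regular \<tau> u \<eta> (z1 + h) (z3 + h)" "R_regular \<tau> u (h - \<eta>) (z1 + \<eta>) (z2 + \<eta>)"
      "R_regular \<tau> u (\<eta> - h) (z2 + h) (z3 + h)" "R_regular \<tau> u h (z1 + \<eta>) (z3 + \<eta>)"
    show "(R_leg \<tau> u 1 2 h (z1 + \<eta>) (z2 + \<eta>) ** R_leg \<tau> u 2 3 \<eta> (z2 + h) (z3 + h)) *v f
        = (R_leg \<tau> u 1 3 \<eta> (z1 + h) (z3 + h) ** R_leg \<tau> u 1 2 (h - \<eta>) (z1 + \<eta>) (z2 + \<eta>)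
          + R_leg \<tau> u 2 3 (\<eta> - h) (z2 + h) (z3 + h) ** R_leg \<tau> u 1 3 h (z1 + \<eta>) (z3 + \<eta>)) *v f"
      using aybe_action[OF reg, where F = "\<lambda>a b c. f $ (a, b, c)"]
      \<comment> \<open>\<open>One_nat_def\<close> is removed so that the position 1 keeps the form
        matched by \<open>R_leg_mult_nth\<close>.\<close>
      by (simp add: vec_eq_iff matrix_vector_mult_add_rdistrib matrix_vector_mul_assoc[symmetric]
          R_leg_mult_nth del: One_nat_def)
  next
    fix f :: "complex^('n \<times> 'n \<times> 'n)"
    assume reg: "R_regular \<tau> u \<eta> z1 z2" "R_regular \<tau> u h (z1 - h) (z3 - h)"
      "R_regular \<tau> u \<eta> z2 z3" "R_regular \<tau> u h (z2 - h) (z3 - h)"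
      "R_regular \<tau> u \<eta> z1 z3" "R_regular \<tau> u h (z1 - h) (z2 - h)"
      "R_regular \<tau> u (h + \<eta>) (z1 - h) (z3 - h)"
    show "(R_leg \<tau> u 1 2 \<eta> z1 z2 ** R_leg \<tau> u 1 3 h (z1 - h) (z3 - h) ** R_leg \<tau> u 2 3 \<eta> z2 z3
        - R_leg \<tau> u 2 3 h (z2 - h) (z3 - h) ** R_leg \<tau> u 1 3 \<eta> z1 z3
            ** R_leg \<tau> u 1 2 h (z1 - h) (z2 - h)) *v f
        = ((weierstrass_p \<tau> \<eta> - weierstrass_p \<tau> h)
            *\<^sub>m R_leg \<tau> u 1 3 (h + \<eta>) (z1 - h) (z3 - h)) *v f"
      using cubic_action[OF reg, where F = "\<lambda>a b c. f $ (a, b, c)"]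
      by (simp add: vec_eq_iff matrix_vector_mult_diff_rdistrib matrix_vector_mul_assoc[symmetric]
          mat_scale_mult R_leg_mult_nth del: One_nat_def)
  qed
qed

end
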